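(* Let $\mu\in\mathbb N^\ell$, let $\ell(\mu)$ be the number of nonzero entries of $\mu$, and suppose $\ell(\mu)\le n$ (with $n\ge2$). Then the dual regular subgraph of the $\widehat{\mathfrak{sl}}_n$-crystal $\mathcal H^\mu$ is connected (as an undirected graph).
   Context: $\mathbb N=\{0,1,\dots\}$. $\mathcal H^\mu=\mathcal H^{1,\mu_\ell}\otimes\cdots\otimes\mathcal H^{1,\mu_1}$ is the set of $H=h_\ell\otimes\cdots\otimes h_1$ with $h_j$ a weakly increasing word of length $\mu_j$ over $\{1,\dots,n\}$, with operators $e_i,f_i:\mathcal H^\mu\to\mathcal H^\mu\sqcup\{\mathbf 0\}$, $0\le i\le n-1$, as follows. For $1\le i\le n-1$ take the word $w=h_\ell\cdots h_1$, replace each $i$ by ")" and each $i+1$ by "(", ignore other letters, and delete successively adjacent pairs "(" ")" until the remaining string is $)\cdots)(\cdots($. $e_i(H)$ changes the $i+1$ of the leftmost remaining "(" into $i$ ($e_i(H)=\mathbf 0$ if none); $f_i(H)$ changes the $i$ of the rightmost remaining ")" into $i+1$ ($\mathbf 0$ if none). For $i=0$ use the word obtained by reversing each $h_j$ before concatenating, with $n$ as ")" and $1$ as "("; $e_0$ changes a $1$ into $n$, $f_0$ changes an $n$ into $1$ by the same rule; words are re-sorted. The crystal graph has vertex set $\mathcal H^\mu$ and arrows $H\xrightarrow{i}f_i(H)$ whenever $f_i(H)\ne\mathbf 0$ (equivalently, edges joining $H'$ and $e_i(H')\neq\mathbf 0$). Energies. For words $a,b$ of lengths $K\le L$: place the letters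 of $a$ as dots in a right column of boxes $1,\dots,n$ (top to bottom), those of $b$ in a left column. Pair each right dot (any order) with the lowest unpaired left dot in a strictly higher box; if none exists, with the lowest unpaired left dot (a winding pair). Move the unpaired left dots to the same boxes of the right column; the right column is now $b'$, the left $a'$; $\mathcal R(a\otimes b)=b'\otimes a'$, $W(a\otimes b)$ = number of winding pairs. For $K>L$, $\mathcal R$ is the inverse of this map and $W(a\otimes b)=W(\mathcal R(a\otimes b))$. $\sigma_i$ applies $\mathcal R$ to the factors $h_{i+1}\otimes h_i$; $W_i(H)=W(h_{i+1}\otimes h_i)$. $D(H)=\sum_{1\le i<j\le\ell}W_i(\sigma_{i+1}\sigma_{i+2}\cdots\sigma_{j-1}(H))$. Let $\sigma^-=(\sigma_1\cdots\sigma_{\ell-1})\cdots(\sigma_1\sigma_2)(\sigma_1)$; $\eta(H)$ is obtained from $\sigma^-(H)$ by reversing the order of the tensor factors and replacing each entry $j$ by $n+1-j$ (re-sorting words). Dual energy: $D'(H)=D(\eta(H))$. A $0$-arrow joining $H$ to $e_0(H)\ne\mathbf 0$ is dual regular if $D'(e_0(H))=D'(H)+1$. The dual regular subgraph of $\mathcal H^\mu$ is obtained from the crystal graph by removing all $0$-arrows that are not dual regular (all arrows with $1\le i\le n-1$ are kept). *)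

theory Defs
  imports "Graph_Theory.Digraph_Component"
begin

type_synonym tensor = "nat list list"

definition words :: "nat \<Rightarrow> nat \<Rightarrow> nat list set" where
  "words n k = {w. sorted w \<and> set w \<subseteq> {1..n} \<and> length w = k}"

text \<open>
  A shape \<open>\<mu>\<close> is listed as \<open>[\<mu>\<^sub>1, \<dots>, \<mu>\<^sub>\<ell>]\<close>, whereas an element
  \<open>h\<^sub>\<ell> \<otimes> \<dots> \<otimes> h\<^sub>1\<close> is listed in the order in which it is written,
  \<open>[h\<^sub>\<ell>, \<dots>, h\<^sub>1]\<close>; hence the \<open>rev\<close>, and the index shift in \<open>factor\<close>.
\<close>

definition tensors :: "nat \<Rightarrow> nat list \<Rightarrow> tensor set" where
  "tensors n \<mu> = listset (map (words n) (rev \<mu>))"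

definition factor :: "tensor \<Rightarrow> nat \<Rightarrow> nat list" where
  "factor H j = H ! (length H - j)"


section \<open>Crystal operators\<close>

text \<open>
  A letter of \<open>H\<close> is addressed by a pair \<open>(k, m)\<close>: position \<open>m\<close> in the list entry \<open>H ! k\<close>
  (both counted from 0 and from the left).
\<close>

definition reading :: "nat \<Rightarrow> tensor \<Rightarrow> (nat \<times> nat) list" where
  "reading i H =
     concat (map (\<lambda>k. map (Pair k)
       (if i = 0 then rev [0..<length (H ! k)] else [0..<length (H ! k)])) [0..<length H])"

definition letter :: "tensor \<Rightarrow> nat \<times> nat \<Rightarrow> nat" where
  "letter H = (\<lambda>(k, m). H ! k ! m)"

datatype bracket = Open | Close

text \<open>For \<open>i = 0\<close> the letters are \<open>1\<close> (opening) and \<open>n\<close> (closing).\<close>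

definition open_letter :: "nat \<Rightarrow> nat" where
  "open_letter i = i + 1"

definition close_letter :: "nat \<Rightarrow> nat \<Rightarrow> nat" where
  "close_letter n i = (if i = 0 then n else i)"

definition bracket_word :: "nat \<Rightarrow> nat \<Rightarrow> tensor \<Rightarrow> ((nat \<times> nat) \<times> bracket) list" where
  "bracket_word n i H =
     map (\<lambda>p. (p, if letter H p = open_letter i then Open else Close))
       (filter (\<lambda>p. letter H p \<in> {open_letter i, close_letter n i}) (reading i H))"

text \<open>
  Deleting adjacent pairs \<open>Open, Close\<close> leaves the same string in whatever order it is
  done. Here the string is built up from its right end, and a new \<open>Open\<close> is deleted together
  with the \<open>Close\<close> that follows it, if there is one.
\<close>

fun cancel_cons :: "'a \<times> bracket \<Rightarrow> ('a \<times> bracket) list \<Rightarrow> ('a \<times> bracket) list" where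
  "cancel_cons (p, Open) ((q, Close) # s) = s"
| "cancel_cons x s = x # s"

definition cancel :: "('a \<times> bracket) list \<Rightarrow> ('a \<times> bracket) list" where
  "cancel s = foldr cancel_cons s []"

definition remaining :: "bracket \<Rightarrow> nat \<Rightarrow> nat \<Rightarrow> tensor \<Rightarrow> (nat \<times> nat) list" where
  "remaining c n i H = map fst (filter (\<lambda>x. snd x = c) (cancel (bracket_word n i H)))"

definition change_letter :: "tensor \<Rightarrow> nat \<times> nat \<Rightarrow> nat \<Rightarrow> tensor" where
  "change_letter H = (\<lambda>(k, m) y. H[k := sort ((H ! k)[m := y])])"

text \<open>The value \<open>None\<close> stands for the extra element \<open>\<^bold>0\<close>.\<close>

definition e_op :: "nat \<Rightarrow> nat \<Rightarrow> tensor \<Rightarrow> tensor option" where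
  "e_op n i H =
     (let ps = remaining Open n i H
      in if ps = [] then None else Some (change_letter H (hd ps) (close_letter n i)))"

definition f_op :: "nat \<Rightarrow> nat \<Rightarrow> tensor \<Rightarrow> tensor option" where
  "f_op n i H =
     (let ps = remaining Close n i H
      in if ps = [] then None else Some (change_letter H (last ps) (open_letter i)))"

text \<open>An arc \<open>(H, i, H')\<close> is the arrow with label \<open>i\<close> from \<open>H\<close> to \<open>H'\<close>.\<close>

definition crystal_graph ::
    "nat \<Rightarrow> nat list \<Rightarrow> (tensor, tensor \<times> nat \<times> tensor) pre_digraph" where
  "crystal_graph n \<mu> =
     \<lparr> verts = tensors n \<mu>,
       arcs = {(H, i, H'). H \<in> tensors n \<mu> \<and> i < n \<and> f_op n i H = Some H'},
       tail = (\<lambda>(H, i, H'). H),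
       head = (\<lambda>(H, i, H'). H') \<rparr>"


section \<open>Combinatorial R-matrix and energy\<close>

text \<open>
  Boxes are numbered from top to bottom, so a strictly higher box has a smaller number and the
  lowest of several dots is the one with the largest number. The right column is \<open>a\<close>, the left
  column \<open>b\<close>. The right dots are paired in the order of the list \<open>a\<close>; the number of winding
  pairs and the multiset of paired left dots do not depend on this order.
\<close>

definition winds :: "nat \<Rightarrow> nat list \<Rightarrow> bool" where
  "winds x b \<longleftrightarrow> \<not> (\<exists>y\<in>set b. y < x)"

definition partner :: "nat \<Rightarrow> nat list \<Rightarrow> nat" where
  "partner x b = (if winds x b then Max (set b) else Max {y \<in> set b. y < x})"

fun paired :: "nat list \<Rightarrow> nat list \<Rightarrow> nat list" where
  "paired [] b = []"
| "paired (x # a) b = partner x b # paired a (remove1 (partner x b) b)"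

fun unpaired :: "nat list \<Rightarrow> nat list \<Rightarrow> nat list" where
  "unpaired [] b = b"
| "unpaired (x # a) b = unpaired a (remove1 (partner x b) b)"

fun winding_number :: "nat list \<Rightarrow> nat list \<Rightarrow> nat" where
  "winding_number [] b = 0"
| "winding_number (x # a) b =
     (if winds x b then 1 else 0) + winding_number a (remove1 (partner x b) b)"

definition R_short :: "nat list \<times> nat list \<Rightarrow> nat list \<times> nat list" where
  "R_short = (\<lambda>(a, b). (sort (a @ unpaired a b), sort (paired a b)))"

definition R_matrix :: "nat \<Rightarrow> nat list \<times> nat list \<Rightarrow> nat list \<times> nat list" where
  "R_matrix n = (\<lambda>(a, b).
     if length a \<le> length b then R_short (a, b)
     else inv_into (words n (length b) \<times> words n (length a)) R_short (a, b))"

definition W :: "nat \<Rightarrow> nat list \<times> nat list \<Rightarrow> nat" where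
  "W n = (\<lambda>(a, b).
     if length a \<le> length b then winding_number a b
     else case R_matrix n (a, b) of (c, d) \<Rightarrow> winding_number c d)"

definition sigma :: "nat \<Rightarrow> nat \<Rightarrow> tensor \<Rightarrow> tensor" where
  "sigma n i H =
     (case R_matrix n (factor H (i + 1), factor H i) of (c, d) \<Rightarrow>
        H[length H - (i + 1) := c, length H - i := d])"

definition W_at :: "nat \<Rightarrow> nat \<Rightarrow> tensor \<Rightarrow> nat" where
  "W_at n i H = W n (factor H (i + 1), factor H i)"

text \<open>
  Products of the operators \<open>\<sigma>\<^sub>i\<close> are compositions of maps, the rightmost factor acting first:
  \<open>foldr (sigma n) [i\<^sub>1, \<dots>, i\<^sub>r] H\<close> is \<open>\<sigma>\<close> at \<open>i\<^sub>1\<close> after \<open>\<dots>\<close> after \<open>\<sigma>\<close> at \<open>i\<^sub>r\<close>, applied to \<open>H\<close>.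
\<close>

definition energy :: "nat \<Rightarrow> tensor \<Rightarrow> nat" where
  "energy n H =
     (\<Sum>j = 1..length H. \<Sum>i = 1..<j. W_at n i (foldr (sigma n) [i + 1..<j] H))"

definition sigma_minus :: "nat \<Rightarrow> tensor \<Rightarrow> tensor" where
  "sigma_minus n H =
     foldr (sigma n) (concat (map (\<lambda>k. [1..<k + 1]) (rev [1..<length H]))) H"

definition eta :: "nat \<Rightarrow> tensor \<Rightarrow> tensor" where
  "eta n H = rev (map (\<lambda>h. sort (map (\<lambda>j. n + 1 - j) h)) (sigma_minus n H))"

definition dual_energy :: "nat \<Rightarrow> tensor \<Rightarrow> nat" where
  "dual_energy n H = energy n (eta n H)"


section \<open>The dual regular subgraph\<close>

text \<open>An arrow \<open>(H, 0, H')\<close> joins \<open>H'\<close> to \<open>e\<^sub>0(H') = H\<close>.\<close>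

definition dual_regular :: "nat \<Rightarrow> tensor \<times> nat \<times> tensor \<Rightarrow> bool" where
  "dual_regular n = (\<lambda>(H, i, H').
     i = 0 \<and> e_op n 0 H' = Some H \<and> dual_energy n H = dual_energy n H' + 1)"

definition dual_regular_subgraph ::
    "nat \<Rightarrow> nat list \<Rightarrow> (tensor, tensor \<times> nat \<times> tensor) pre_digraph" where
  "dual_regular_subgraph n \<mu> = (crystal_graph n \<mu>)
     \<lparr> arcs := {(H, i, H') \<in> arcs (crystal_graph n \<mu>). i = 0 \<longrightarrow> dual_regular n (H, i, H')} \<rparr>"

end

theory Submission
  imports Defs "HOL-Library.Multiset"
begin

text \<open>
  Put \<open>G = \<eta>(H)\<close>. Since \<open>\<eta>\<close> exchanges \<open>e\<^sub>i\<close> with \<open>f\<^bsub>n-i\<^esub>\<close> and \<open>e\<^sub>0\<close> with \<open>f\<^sub>0\<close>, one has to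
  connect all \<open>G\<close> by the operators with \<open>i \<ge> 1\<close> and by those \<open>f\<^sub>0\<close> that raise the energy \<open>D\<close>
  by 1. The local energies telescope: \<open>D(f\<^sub>0 G) - D(G)\<close> is 1 minus the number of \<open>j\<close> such that
  \<open>f\<^sub>0\<close> acts on the rightmost factor of \<open>\<sigma>\<^sub>1 \<dots> \<sigma>\<^bsub>j-1\<^esub> G\<close>. If \<open>G\<close> is of highest weight for the
  operators with \<open>i \<ge> 1\<close>, then so are all these tensors, hence their rightmost factors contain
  only the letter 1, and \<open>f\<^sub>0\<close> raises \<open>D\<close> as soon as it does not vanish. It does not vanish
  if \<open>n\<close> occurs in \<open>G\<close>: at most \<open>n\<close> factors are nonempty, so \<open>n\<close> occurs only in the leftmost
  one of them. If the largest letter \<open>r\<close> of \<open>G\<close> satisfies \<open>1 < r < n\<close>, one first increases all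
  letters by \<open>n - r\<close> using \<open>f\<^sub>1, \<dots>, f\<^bsub>n-1\<^esub>\<close>; the rightmost factors stay constant and there
  is no letter 1 left to cancel with the \<open>n\<close>. As \<open>D\<close> is bounded, every \<open>G\<close> is connected to the
  tensor all of whose letters are 1.
\<close>

section \<open>Crystal operators by recursion on the factors\<close>

text \<open>The obstacle is the R-matrix: it is given by a recursion along a list, and for a longer
  left word only as an inverse function. It is therefore replaced by a relation between
  multiplicities, a flow of arcs on the cycle of boxes. The flow is unique for given columns, and
  the columns can be recovered from its result; with a count of the finite sets of words this makes
  R a bijection, and the case of a longer left word is the same relation read backwards. An operator
  f_i moves one dot to the next box and changes the flow in at most two boxes, which yields both the
  commutation with R and the change of W. The rightmost factors enter as boundary terms of the
  telescoping sum. The shift by n - r is harmless because classical operators keep the energy and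
  pairing only compares letters. The bound on the number of nonempty factors matters when r = n:
  then letters 1 are present and could cancel every n. At the end the \<eta>-images of two endpoints
  agree, and injectivity of \<eta> identifies the endpoints themselves.\<close>

definition cnt :: "nat list \<Rightarrow> nat \<Rightarrow> nat" where
  "cnt h c = count (mset h) c"

lemma cnt_pos_iff: "cnt h c > 0 \<longleftrightarrow> c \<in> set h"
  by (simp add: cnt_def)

text \<open>What \<open>cancel\<close> leaves is a run of Closes followed by a run of Opens, so the
  two runs can be computed as lists of their own. An Open deletes the first Close surviving to its
  right; \<open>tl [] = []\<close> covers the case that there is none.\<close>

fun closes :: "('a \<times> bracket) list \<Rightarrow> 'a list" where
  "closes [] = []"
| "closes ((p, Close) # s) = p # closes s"
| "closes ((p, Open) # s) = tl (closes s)"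

fun opens :: "('a \<times> bracket) list \<Rightarrow> 'a list" where
  "opens [] = []"
| "opens ((p, Close) # s) = opens s"
| "opens ((p, Open) # s) = (if closes s = [] then p # opens s else opens s)"

lemma cancel_eq: "cancel s = map (\<lambda>p. (p, Close)) (closes s) @ map (\<lambda>p. (p, Open)) (opens s)"
proof (induction s rule: closes.induct)
  case (3 p s)
  then show ?case
    by (cases "closes s"; cases "opens s") (auto simp: cancel_def)
qed (auto simp: cancel_def)

lemma remaining_Close: "remaining Close n i H = closes (bracket_word n i H)"
  by (simp add: remaining_def cancel_eq filter_map comp_def)

lemma remaining_Open: "remaining Open n i H = opens (bracket_word n i H)"
  by (simp add: remaining_def cancel_eq filter_map comp_def)

text \<open>Only the surviving Opens of \<open>s\<close> meet the surviving Closes of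
  \<open>t\<close>: the last of these Opens are deleted with the first of these Closes, one for
  one.\<close>

lemma closes_opens_append:
  "closes (s @ t) = closes s @ drop (length (opens s)) (closes t)
   \<and> opens (s @ t) = take (length (opens s) - length (closes t)) (opens s) @ opens t"
proof (induction s rule: closes.induct)
  case (3 p s)
  show ?case
  proof (cases "closes s")
    case Nil
    show ?thesis
    proof (cases "length (closes t) \<le> length (opens s)")
      case True
      then show ?thesis using 3 Nil by (simp add: Suc_diff_le)
    next
      case False
      then show ?thesis using 3 Nil
        by (simp add: drop_Suc tl_drop)
    qed
  next
    case (Cons a l)
    then show ?thesis using 3 by simp
  qed
qed auto

lemma closes_map: "closes (map (apfst g) s) = map g (closes s)"
  by (induction s rule: closes.induct) (auto simp: map_tl)

lemma opens_map: "opens (map (apfst g) s) = map g (opens s)"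
  by (induction s rule: closes.induct) (auto simp: closes_map)

lemma closes_opens_sorted:
  assumes "sorted_wrt (\<lambda>x y. \<not> (snd x = Open \<and> snd y = Close)) s"
  shows "closes s = map fst (filter (\<lambda>x. snd x = Close) s)"
    "opens s = map fst (filter (\<lambda>x. snd x = Open) s)"
  using assms
proof (induction s rule: closes.induct)
  case (3 p s)
  { case 1
    with 3 have "closes s = []"
      by (auto simp: filter_empty_conv)
    moreover have "filter (\<lambda>x. snd x = Close) s = []"
      using 1 by (auto simp: filter_empty_conv)
    ultimately show ?case by simp
  next
    case 2
    with 3 have "closes s = []"
      by (auto simp: filter_empty_conv)
    then show ?case using 3 2 by auto }
qed auto

definition word_of :: "nat \<Rightarrow> nat \<Rightarrow> nat list \<Rightarrow> (nat \<times> bracket) list" where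
  "word_of n i h = map (\<lambda>m. (m, if h ! m = open_letter i then Open else Close))
     (filter (\<lambda>m. h ! m \<in> {open_letter i, close_letter n i})
       (if i = 0 then rev [0..<length h] else [0..<length h]))"

lemma reading_Cons:
  "reading i (h # H) =
     map (Pair 0) (if i = 0 then rev [0..<length h] else [0..<length h]) @
     map (apfst Suc) (reading i H)"
proof -
  have "[0..<length (h # H)] = 0 # map Suc [0..<length H]"
    by (metis length_Cons map_Suc_upt upt_conv_Cons zero_less_Suc)
  then show ?thesis
    by (simp add: reading_def map_concat comp_def del: upt_Suc)
qed

lemma bracket_word_Cons:
  "bracket_word n i (h # H) =
     map (apfst (Pair 0)) (word_of n i h) @ map (apfst (apfst Suc)) (bracket_word n i H)"
  by (simp add: bracket_word_def reading_Cons word_of_def filter_map comp_def letter_def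
      case_prod_unfold del: upt_Suc)

lemma bracket_word_Nil: "bracket_word n i [] = []"
  by (simp add: bracket_word_def reading_def)

lemma close_neq_open: "n \<ge> 2 \<Longrightarrow> i < n \<Longrightarrow> close_letter n i \<noteq> open_letter i"
  by (auto simp: close_letter_def open_letter_def)

text \<open>Nothing cancels inside one factor. In a weakly increasing word the letters i precede the
  letters i+1; for i = 0 the word is read backwards, which puts the letters n before the letters
  1.\<close>

lemma word_of_sorted:
  assumes "sorted h" "i < n" "n \<ge> 2"
  shows "sorted_wrt (\<lambda>x y. \<not> (snd x = Open \<and> snd y = Close)) (word_of n i h)"
proof -
  let ?g = "\<lambda>m. (m, if h ! m = open_letter i then Open else Close)"
  have rel: "(\<lambda>x y. \<not> (snd (?g x) = Open \<and> snd (?g y) = Close))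
      = (\<lambda>x y. \<not> (h ! x = open_letter i \<and> h ! y \<noteq> open_letter i))"
    by (auto simp: fun_eq_iff)
  show ?thesis
  proof (cases "i = 0")
    case True
    have "sorted_wrt (\<lambda>x y. \<not> (h ! x = open_letter i \<and> h ! y \<noteq> open_letter i))
       (filter (\<lambda>m. h ! m \<in> {open_letter i, close_letter n i}) (rev [0..<length h]))"
      unfolding rev_filter[symmetric] sorted_wrt_rev
    proof (rule sorted_wrt_mono_rel[of _ "(<)"])
      fix x y
      assume xy: "x \<in> set (filter (\<lambda>m. h ! m \<in> {open_letter i, close_letter n i}) [0..<length h])"
        "y \<in> set (filter (\<lambda>m. h ! m \<in> {open_letter i, close_letter n i}) [0..<length h])" "x < y"
      then have "h ! x \<le> h ! y" using assms by (auto intro: sorted_nth_mono)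
      then show "\<not> (h ! y = open_letter i \<and> h ! x \<noteq> open_letter i)"
        using xy True assms by (auto simp: open_letter_def close_letter_def)
    qed (simp add: sorted_wrt_filter)
    then show ?thesis using True
      unfolding word_of_def sorted_wrt_map rel by simp
  next
    case False
    have "sorted_wrt (\<lambda>x y. \<not> (h ! x = open_letter i \<and> h ! y \<noteq> open_letter i))
       (filter (\<lambda>m. h ! m \<in> {open_letter i, close_letter n i}) ([0..<length h]))"
    proof (rule sorted_wrt_mono_rel[of _ "(<)"])
      fix x y
      assume xy: "x \<in> set (filter (\<lambda>m. h ! m \<in> {open_letter i, close_letter n i}) [0..<length h])"
        "y \<in> set (filter (\<lambda>m. h ! m \<in> {open_letter i, close_letter n i}) [0..<length h])" "x < y"
      then have "h ! x \<le> h ! y" using assms by (auto intro: sorted_nth_mono)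
      then show "\<not> (h ! x = open_letter i \<and> h ! y \<noteq> open_letter i)"
        using xy False assms by (auto simp: open_letter_def close_letter_def)
    qed (simp add: sorted_wrt_filter)
    then show ?thesis using False
      unfolding word_of_def sorted_wrt_map rel by simp
  qed
qed

lemma length_filter_nth: "length (filter (\<lambda>m. h ! m = c) [0..<length h]) = cnt h c"
proof -
  have "length (filter (\<lambda>m. h ! m = c) [0..<length h])
      = length (filter (\<lambda>x. x = c) (map ((!) h) [0..<length h]))"
    by (simp add: filter_map comp_def)
  then show ?thesis
    by (simp only: cnt_def map_nth count_mset count_list_eq_length_filter) (metis (mono_tags, lifting) filter_cong)
qed

lemma length_filter_nth_rev: "length (filter (\<lambda>m. h ! m = c) (rev [0..<length h])) = cnt h c"
  by (metis length_filter_nth length_rev rev_filter)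

lemma word_of_remaining:
  assumes "sorted h" "i < n" "n \<ge> 2"
  shows "length (closes (word_of n i h)) = cnt h (close_letter n i)"
    "length (opens (word_of n i h)) = cnt h (open_letter i)"
    "m \<in> set (closes (word_of n i h)) \<Longrightarrow> m < length h \<and> h ! m = close_letter n i"
    "m \<in> set (opens (word_of n i h)) \<Longrightarrow> m < length h \<and> h ! m = open_letter i"
proof -
  note ne = close_neq_open[OF assms(3,2)]
  note co = closes_opens_sorted[OF word_of_sorted[OF assms]]
  let ?g = "\<lambda>m. (m, if h ! m = open_letter i then Open else Close)"
  let ?P = "\<lambda>m. h ! m \<in> {open_letter i, close_letter n i}"
  have "map fst (filter (\<lambda>x. snd x = Close) (map ?g (filter ?P l)))
      = filter (\<lambda>m. h ! m = close_letter n i) l" for l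
    using ne[symmetric] by (induction l) simp_all
  then have c: "closes (word_of n i h) = filter (\<lambda>m. h ! m = close_letter n i)
       (if i = 0 then rev [0..<length h] else [0..<length h])"
    unfolding co(1) by (simp only: word_of_def)
  have "map fst (filter (\<lambda>x. snd x = Open) (map ?g (filter ?P l)))
      = filter (\<lambda>m. h ! m = open_letter i) l" for l
    using ne[symmetric] by (induction l) simp_all
  then have d: "opens (word_of n i h) = filter (\<lambda>m. h ! m = open_letter i)
       (if i = 0 then rev [0..<length h] else [0..<length h])"
    unfolding co(2) by (simp only: word_of_def)
  show "length (closes (word_of n i h)) = cnt h (close_letter n i)"
    unfolding c using length_filter_nth length_filter_nth_rev by (cases "i = 0") (simp_all only: if_True if_False refl simp_thms)
  show "length (opens (word_of n i h)) = cnt h (open_letter i)"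
    unfolding d using length_filter_nth length_filter_nth_rev by (cases "i = 0") (simp_all only: if_True if_False refl simp_thms)
  show "m \<in> set (closes (word_of n i h)) \<Longrightarrow> m < length h \<and> h ! m = close_letter n i"
    unfolding c by (auto split: if_splits)
  show "m \<in> set (opens (word_of n i h)) \<Longrightarrow> m < length h \<and> h ! m = open_letter i"
    unfolding d by (auto split: if_splits)
qed

section \<open>String lengths and the tensor product rule\<close>

definition phi :: "nat \<Rightarrow> nat \<Rightarrow> tensor \<Rightarrow> nat" where
  "phi n i H = length (remaining Close n i H)"

definition eps :: "nat \<Rightarrow> nat \<Rightarrow> tensor \<Rightarrow> nat" where
  "eps n i H = length (remaining Open n i H)"

definition upd :: "nat \<Rightarrow> nat \<Rightarrow> nat list \<Rightarrow> nat list" where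
  "upd x y h = sort (y # remove1 x h)"

lemma sorted_upd [simp]: "sorted (upd x y h)"
  by (simp only: upd_def sorted_sort)

lemma mset_upd: "mset (upd x y h) = add_mset y (mset h - {#x#})"
  by (simp add: upd_def)

lemma cnt_upd: "x \<in> set h \<Longrightarrow> cnt (upd x y h) z = cnt h z + of_bool (z = y) - of_bool (z = x)"
  by (auto simp: cnt_def mset_upd)

lemma sort_list_update:
  assumes "m < length h" shows "sort (h[m := y]) = upd (h ! m) y h"
  unfolding upd_def
  by (rule properties_for_sort)
    (use assms in \<open>simp_all only: sorted_sort mset_sort mset_update mset.simps mset_remove1\<close>)

lemma phi_Nil [simp]: "phi n i [] = 0" and eps_Nil [simp]: "eps n i [] = 0"
  by (simp_all add: phi_def eps_def remaining_Close remaining_Open bracket_word_Nil)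

lemma f_op_None_iff: "f_op n i H = None \<longleftrightarrow> phi n i H = 0"
  by (auto simp: f_op_def phi_def Let_def)

lemma e_op_None_iff: "e_op n i H = None \<longleftrightarrow> eps n i H = 0"
  by (auto simp: e_op_def eps_def Let_def)

lemma f_op_Nil [simp]: "f_op n i [] = None" and e_op_Nil [simp]: "e_op n i [] = None"
  by (simp_all add: f_op_None_iff e_op_None_iff)

lemma change_letter_Suc: "change_letter (h # H) (apfst Suc p) y = h # change_letter H p y"
  by (cases p) (simp add: change_letter_def)

text \<open>The tensor product rule of crystals; later arguments use it in place of positions in a
  word. The Opens of \<open>h\<close> meet the Closes that survive in \<open>H\<close>, and
  truncated subtraction counts what is left on either side. \<open>f_op\<close> wants the rightmost
  Close and so prefers \<open>H\<close>, while \<open>e_op\<close> wants the leftmost Open and so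
  prefers \<open>h\<close>.\<close>

lemma
  assumes "sorted h" "i < n" "n \<ge> 2"
  shows phi_Cons: "phi n i (h # H) = cnt h (close_letter n i) + (phi n i H - cnt h (open_letter i))"
    and eps_Cons: "eps n i (h # H) = (cnt h (open_letter i) - phi n i H) + eps n i H"
    and f_op_Cons: "f_op n i (h # H) =
      (if phi n i H > cnt h (open_letter i) then map_option ((#) h) (f_op n i H)
       else if cnt h (close_letter n i) > 0 then Some (upd (close_letter n i) (open_letter i) h # H)
       else None)"
    and e_op_Cons: "e_op n i (h # H) =
      (if cnt h (open_letter i) > phi n i H then Some (upd (open_letter i) (close_letter n i) h # H)
       else map_option ((#) h) (e_op n i H))"
proof -
  note w = word_of_remaining[OF assms]
  let ?w = "word_of n i h"
  have C: "remaining Close n i (h # H) = map (Pair 0) (closes ?w) @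
      drop (cnt h (open_letter i)) (map (apfst Suc) (remaining Close n i H))"
    by (simp add: remaining_Close bracket_word_Cons closes_opens_append closes_map opens_map w)
  have O: "remaining Open n i (h # H) =
      take (cnt h (open_letter i) - phi n i H) (map (Pair 0) (opens ?w)) @
      map (apfst Suc) (remaining Open n i H)"
    by (simp add: remaining_Open bracket_word_Cons closes_opens_append closes_map opens_map w
        phi_def remaining_Close)
  show phi: "phi n i (h # H) = cnt h (close_letter n i) + (phi n i H - cnt h (open_letter i))"
    by (simp add: phi_def C w)
  show "eps n i (h # H) = (cnt h (open_letter i) - phi n i H) + eps n i H"
    by (simp add: eps_def O w)
  show "f_op n i (h # H) =
      (if phi n i H > cnt h (open_letter i) then map_option ((#) h) (f_op n i H)
       else if cnt h (close_letter n i) > 0 then Some (upd (close_letter n i) (open_letter i) h # H)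
       else None)"
  proof (cases "phi n i H > cnt h (open_letter i)")
    case True
    then have "remaining Close n i H \<noteq> []" by (auto simp: phi_def)
    moreover have "last (remaining Close n i (h # H)) = apfst Suc (last (remaining Close n i H))"
      using True unfolding C by (auto simp: phi_def last_append drop_map last_map)
    moreover have "remaining Close n i (h # H) \<noteq> []"
      using True unfolding C by (simp add: phi_def)
    ultimately show ?thesis
      using True by (simp add: f_op_def Let_def change_letter_Suc)
  next
    case False
    then have C': "remaining Close n i (h # H) = map (Pair 0) (closes ?w)"
      unfolding C by (simp add: phi_def)
    show ?thesis
    proof (cases "closes ?w = []")
      case True
      then show ?thesis using False w(1) by (simp add: f_op_def Let_def C')
    next
      case ne: False
      then have "last (closes ?w) \<in> set (closes ?w)" by simp
      then show ?thesis using False ne w(1) w(3)[of "last (closes ?w)"]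
        by (auto simp: f_op_def Let_def C' last_map change_letter_def sort_list_update
            simp flip: w(1))
    qed
  qed
  show "e_op n i (h # H) =
      (if cnt h (open_letter i) > phi n i H then Some (upd (open_letter i) (close_letter n i) h # H)
       else map_option ((#) h) (e_op n i H))"
  proof (cases "cnt h (open_letter i) > phi n i H")
    case True
    then have "length (opens ?w) > 0"
      using w(2) by linarith
    then obtain p ps where op: "opens ?w = p # ps"
      by (cases "opens ?w") auto
    then have "p < length h \<and> h ! p = open_letter i"
      using w(4)[of p] by simp
    moreover from True obtain k where "cnt h (open_letter i) - phi n i H = Suc k"
      by (cases "cnt h (open_letter i) - phi n i H") simp_all
    ultimately show ?thesis using True op
      by (simp add: e_op_def Let_def O change_letter_def sort_list_update)
  next
    case False
    then have O': "remaining Open n i (h # H) = map (apfst Suc) (remaining Open n i H)"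
      unfolding O by simp
    show ?thesis
    proof (cases "remaining Open n i H")
      case Nil
      then show ?thesis using False by (simp add: e_op_def O')
    next
      case (Cons p ps)
      then show ?thesis using False by (simp add: e_op_def O' change_letter_Suc)
    qed
  qed
qed

section \<open>Blocks of factors and the mutual inverses \<open>e_op\<close> and
  \<open>f_op\<close>\<close>

definition valid :: "nat \<Rightarrow> tensor \<Rightarrow> bool" where
  "valid n H \<longleftrightarrow> (\<forall>h\<in>set H. sorted h \<and> set h \<subseteq> {1..n})"

lemma valid_Nil [simp]: "valid n []"
  and valid_Cons [simp]: "valid n (h # H) \<longleftrightarrow> sorted h \<and> set h \<subseteq> {1..n} \<and> valid n H"
  and valid_append [simp]: "valid n (A @ B) \<longleftrightarrow> valid n A \<and> valid n B"
  by (auto simp: valid_def)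

text \<open>
  The position of the factor changed by \<open>f\<^sub>i\<close>, counted from the right and starting at 1;
  it is 0 if \<open>f\<^sub>i\<close> vanishes.
\<close>

fun pos :: "nat \<Rightarrow> nat \<Rightarrow> tensor \<Rightarrow> nat" where
  "pos n i [] = 0"
| "pos n i (h # H) = (if phi n i H > cnt h (open_letter i) then pos n i H
     else if cnt h (close_letter n i) > 0 then Suc (length H) else 0)"

context
  fixes n i :: nat
  assumes i: "i < n" and n: "n \<ge> 2"
begin

lemma pos_le: "pos n i H \<le> length H"
  by (induction H) auto

lemma pos_pos_iff: "valid n H \<Longrightarrow> pos n i H > 0 \<longleftrightarrow> phi n i H > 0"
  by (induction H) (auto simp: phi_Cons i n)

text \<open>The product rule for whole blocks. It serves to isolate the two neighbouring factors
  that an operator sigma_i changes: the rest of the tensor sees only their \<open>phi\<close> and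
  \<open>eps\<close>.\<close>

lemma phi_eps_append:
  assumes "valid n A" "valid n B"
  shows "phi n i (A @ B) = phi n i A + (phi n i B - eps n i A)
    \<and> eps n i (A @ B) = (eps n i A - phi n i B) + eps n i B"
  using assms(1)
  by (induction A) (use assms(2) in \<open>auto simp: phi_Cons eps_Cons i n\<close>)

lemmas phi_append = phi_eps_append[THEN conjunct1]
lemmas eps_append = phi_eps_append[THEN conjunct2]

lemma f_op_append:
  assumes "valid n A" "valid n B"
  shows "f_op n i (A @ B) = (if phi n i B > eps n i A then map_option ((@) A) (f_op n i B)
     else map_option (\<lambda>A. A @ B) (f_op n i A))"
  using assms(1)
proof (induction A)
  case Nil
  then show ?case using f_op_None_iff[of n i B] by (cases "f_op n i B") auto
next
  case (Cons h A)
  then show ?case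
    using assms(2) f_op_None_iff[of n i A] f_op_None_iff[of n i B]
    by (auto simp: f_op_Cons phi_Cons eps_Cons i n phi_append option.map_comp comp_def)
qed

lemma pos_append:
  assumes "valid n A" "valid n B"
  shows "pos n i (A @ B) = (if phi n i B > eps n i A then pos n i B
     else if pos n i A > 0 then pos n i A + length B else 0)"
  using assms(1)
proof (induction A)
  case Nil
  then show ?case using assms pos_pos_iff[of B] by auto
next
  case (Cons h A)
  then show ?case
    using assms(2) pos_pos_iff[of A]
    by (auto simp: phi_Cons eps_Cons i n phi_append)
qed

lemma letters_le:
  "close_letter n i \<in> {1..n}" "open_letter i \<in> {1..n}" "close_letter n i \<noteq> open_letter i"
  using i n by (auto simp: close_letter_def open_letter_def)

lemma length_upd: "x \<in> set h \<Longrightarrow> length (upd x y h) = length h"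
  using length_pos_if_in_set[of x h] by (simp add: upd_def length_remove1)

lemma set_upd: "set (upd x y h) \<subseteq> insert y (set h)"
  using set_remove1_subset[of x h] by (auto simp only: upd_def set_sort list.simps)

lemma set_upd_range: "set h \<subseteq> {1..n} \<Longrightarrow> y \<in> {1..n} \<Longrightarrow> set (upd x y h) \<subseteq> {1..n}"
  using set_upd[of x y h] by blast

lemma upd_upd: "sorted h \<Longrightarrow> x \<in> set h \<Longrightarrow> upd y x (upd x y h) = h"
  unfolding upd_def[of y x]
  by (rule properties_for_sort) (auto simp: mset_upd)

lemma f_op_valid:
  assumes "valid n H" "f_op n i H = Some H'"
  shows "valid n H' \<and> map length H' = map length H"
  using assms
proof (induction H arbitrary: H')
  case (Cons h H)
  then show ?case using set_upd_range[OF _ letters_le(2)]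
    by (auto simp: f_op_Cons i n length_upd cnt_pos_iff split: if_splits simp del: atLeastAtMost_iff One_nat_def)
qed simp

lemma e_op_valid:
  assumes "valid n H" "e_op n i H = Some H'"
  shows "valid n H' \<and> map length H' = map length H"
  using assms
proof (induction H arbitrary: H')
  case (Cons h H)
  then show ?case using set_upd_range[OF _ letters_le(1)]
    using cnt_pos_iff[of h "open_letter i"]
    by (auto simp: e_op_Cons i n length_upd split: if_splits simp del: atLeastAtMost_iff One_nat_def)
qed simp

lemma f_op_inverse:
  assumes "valid n H" "f_op n i H = Some H'"
  shows "e_op n i H' = Some H \<and> phi n i H = Suc (phi n i H') \<and> eps n i H' = Suc (eps n i H)"
  using assms
proof (induction H arbitrary: H')
  case (Cons h H)
  have v: "valid n H" "sorted h" using Cons by auto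
  show ?case
  proof (cases "phi n i H > cnt h (open_letter i)")
    case True
    then obtain H1 where H1: "f_op n i H = Some H1" "H' = h # H1"
      using Cons.prems v by (auto simp: f_op_Cons i n)
    then show ?thesis
      using Cons.IH[OF v(1) H1(1)] f_op_valid[OF v(1) H1(1)] True v
      by (auto simp: e_op_Cons i n phi_Cons eps_Cons)
  next
    case False
    then have "cnt h (close_letter n i) > 0" and H': "H' = upd (close_letter n i) (open_letter i) h # H"
      using Cons.prems v by (auto simp: f_op_Cons i n split: if_splits)
    then have "close_letter n i \<in> set h" by (simp add: cnt_pos_iff)
    then show ?thesis using False v letters_le(3) cnt_pos_iff[of h "close_letter n i"] unfolding H'
      by (auto simp: e_op_Cons i n phi_Cons eps_Cons cnt_upd upd_upd)
  qed
qed simp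

lemma e_op_inverse:
  assumes "valid n H" "e_op n i H = Some H'"
  shows "f_op n i H' = Some H"
  using assms
proof (induction H arbitrary: H')
  case (Cons h H)
  have v: "valid n H" "sorted h" using Cons by auto
  show ?case
  proof (cases "cnt h (open_letter i) > phi n i H")
    case True
    then have H': "H' = upd (open_letter i) (close_letter n i) h # H"
      using Cons.prems v by (auto simp: e_op_Cons i n split: if_splits)
    have "cnt h (open_letter i) > 0" using True by simp
    then have "open_letter i \<in> set h" by (simp add: cnt_pos_iff)
    then show ?thesis using True v letters_le(3) cnt_pos_iff[of h "open_letter i"] unfolding H'
      by (auto simp: f_op_Cons i n cnt_upd upd_upd)
  next
    case False
    then obtain H1 where H1: "e_op n i H = Some H1" "H' = h # H1"
      using Cons.prems v by (auto simp: e_op_Cons i n)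
    have f: "f_op n i H1 = Some H" by (rule Cons.IH[OF v(1) H1(1)])
    have "valid n H1" using e_op_valid[OF v(1) H1(1)] by simp
    from f_op_inverse[OF this f] f show ?thesis
      using False v H1
      by (auto simp: f_op_Cons i n)
  qed
qed simp

end

section \<open>Cyclic pairings\<close>

definition next_box :: "nat \<Rightarrow> nat \<Rightarrow> nat" where
  "next_box n c = (if c = n then 1 else Suc c)"

text \<open>
  \<open>X c\<close> and \<open>Y c\<close> count the right and left dots in box \<open>c\<close>, \<open>P c\<close> the paired left dots, and
  \<open>V c\<close> the pairs that pass over box \<open>c\<close> when every pair is drawn as an arc going down
  from its left dot, from box \<open>n\<close> on to box \<open>1\<close> for a winding pair. No arc passes over an
  unpaired left dot. The last condition is needed for uniqueness if both columns have the same
  length: otherwise all arcs could go round once more.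
\<close>

definition arcs_over :: "nat \<Rightarrow> (nat \<Rightarrow> nat) \<Rightarrow> (nat \<Rightarrow> nat) \<Rightarrow> (nat \<Rightarrow> nat) \<Rightarrow> (nat \<Rightarrow> nat) \<Rightarrow> bool" where
  "arcs_over n X Y P V \<longleftrightarrow>
     (\<forall>c\<in>{1..n}. P c \<le> Y c \<and> (P c = Y c \<or> V c = 0) \<and> V c + P c = X (next_box n c) + V (next_box n c)) \<and>
     (\<exists>c\<in>{1..n}. V c = 0)"

lemma arcs_overD:
  assumes "arcs_over n X Y P V" "c \<in> {1..n}"
  shows "P c \<le> Y c" "P c = Y c \<or> V c = 0" "V c + P c = X (next_box n c) + V (next_box n c)"
  using assms by (auto simp: arcs_over_def)

lemma next_box_range: "c \<in> {1..n} \<Longrightarrow> next_box n c \<in> {1..n}"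
  by (auto simp: next_box_def)

section \<open>Uniqueness of the arcs and recovery of the two columns\<close>

lemma next_box_closed_imp_all:
  assumes step: "\<And>c. c \<in> {1..n} \<Longrightarrow> Q c \<Longrightarrow> Q (next_box n c)" and "c \<in> {1..n}" "Q c" "d \<in> {1..n}"
  shows "Q d"
proof -
  have up: "Q b" if "Q a" "a \<in> {1..n}" "a \<le> b" "b \<le> n" for a b
    using that(3,4,1,2)
  proof (induction b rule: dec_induct)
    case (step m)
    then show ?case using assms(1)[of m] by (auto simp: next_box_def)
  qed
  have "Q n" using up assms by auto
  then have "Q 1" using assms(1)[of n] assms(2) by (auto simp: next_box_def)
  then show ?thesis using up assms by auto
qed

lemma next_box_pred_closed_imp_all:
  assumes step: "\<And>c. c \<in> {1..n} \<Longrightarrow> Q (next_box n c) \<Longrightarrow> Q c" and c: "c \<in> {1..n}" "Q c" and d: "d \<in> {1..n}"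
  shows "Q d"
proof (rule ccontr)
  assume "\<not> Q d"
  then have "\<not> Q c"
    using next_box_closed_imp_all[of n "\<lambda>c. \<not> Q c" d c] step c d by blast
  then show False using c by simp
qed

text \<open>An excess of V' + P' over V + P runs round the cycle. By the balance equation it gives
  V' > V in the next box; there V' > 0 forces P' = Y \<ge> P, so the excess persists. Then V' is
  positive everywhere, against the last condition of \<open>arcs_over\<close>.\<close>

lemma arcs_over_le:
  assumes "arcs_over n X Y P V" "arcs_over n X Y P' V'" "c \<in> {1..n}"
  shows "V' c + P' c \<le> V c + P c"
proof (rule ccontr)
  assume contra: "\<not> ?thesis"
  have step: "V' (next_box n a) + P' (next_box n a) > V (next_box n a) + P (next_box n a) \<and> V' (next_box n a) > 0"
    if "a \<in> {1..n}" "V' a + P' a > V a + P a" for a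
  proof -
    have b: "next_box n a \<in> {1..n}" using that next_box_range by blast
    have "V' (next_box n a) > V (next_box n a)"
      using that(2) arcs_overD(3)[OF assms(1) that(1)] arcs_overD(3)[OF assms(2) that(1)] by linarith
    moreover from this have "P' (next_box n a) = Y (next_box n a)"
      using arcs_overD(2)[OF assms(2) b] by linarith
    ultimately show ?thesis
      using arcs_overD(1)[OF assms(1) b] by linarith
  qed
  have all: "V' a + P' a > V a + P a" if "a \<in> {1..n}" for a
    by (rule next_box_closed_imp_all[of n "\<lambda>a. V' a + P' a > V a + P a" c a])
      (use step contra assms(3) that in \<open>blast, blast, linarith, blast\<close>)
  have "V' a > 0" if "a \<in> {1..n}" for a
    by (rule next_box_closed_imp_all[of n "\<lambda>a. V' a > 0" "next_box n c" a])
      (use step all next_box_range assms(3) that in blast)+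
  then show False using assms(2) unfolding arcs_over_def by force
qed

text \<open>The sum V + P determines both summands: since P \<le> Y, and P = Y or V = 0, the value
  of P is the minimum of Y and V + P.\<close>

lemma arcs_over_unique:
  assumes "arcs_over n X Y P V" "arcs_over n X Y P' V'" "c \<in> {1..n}"
  shows "P' c = P c" "V' c = V c"
proof -
  have "V' c + P' c = V c + P c"
    using arcs_over_le[OF assms(1,2,3)] arcs_over_le[OF assms(2,1,3)] by simp
  then show "P' c = P c" "V' c = V c"
    using arcs_overD(1,2)[OF assms(1,3)] arcs_overD(1,2)[OF assms(2,3)] by (elim disjE; linarith)+
qed

text \<open>This is the source of the injectivity of R, whose result fixes P and X + Y. The excess
  now runs against the arcs: from the next box it gives V' > V at \<open>a\<close>, hence Y' = P' =
  P \<le> Y, hence X' \<ge> X because X + Y is fixed.\<close>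

lemma arcs_over_inject:
  assumes "arcs_over n X Y P V" "arcs_over n X' Y' P' V'"
    and P: "\<And>c. c \<in> {1..n} \<Longrightarrow> P' c = P c"
    and B: "\<And>c. c \<in> {1..n} \<Longrightarrow> X' c + Y' c = X c + Y c"
    and c: "c \<in> {1..n}"
  shows "X' c + V' c \<le> X c + V c"
proof (rule ccontr)
  assume contra: "\<not> ?thesis"
  have step: "V' a > V a \<and> V' a + X' a > V a + X a"
    if "a \<in> {1..n}" "V' (next_box n a) + X' (next_box n a) > V (next_box n a) + X (next_box n a)" for a
  proof -
    have "V' a > V a"
      using arcs_overD(3)[OF assms(1) that(1)] arcs_overD(3)[OF assms(2) that(1)] P[OF that(1)]
        that(2) by linarith
    moreover from this have "P' a = Y' a"
      using arcs_overD(2)[OF assms(2) that(1)] by linarith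
    ultimately show ?thesis
      using arcs_overD(1)[OF assms(1) that(1)] P[OF that(1)] B[OF that(1)] by linarith
  qed
  have all: "V' a + X' a > V a + X a" if "a \<in> {1..n}" for a
    by (rule next_box_pred_closed_imp_all[of n "\<lambda>a. V' a + X' a > V a + X a" c a])
      (use step contra c that in \<open>blast, blast, linarith, blast\<close>)
  have "V' a > 0" if "a \<in> {1..n}" for a
    using step[OF that] all[OF next_box_range[OF that]] by linarith
  then show False using assms(2) unfolding arcs_over_def by force
qed

lemma arcs_over_inject_eq:
  assumes "arcs_over n X Y P V" "arcs_over n X' Y' P' V'"
    and P: "\<And>c. c \<in> {1..n} \<Longrightarrow> P' c = P c"
    and B: "\<And>c. c \<in> {1..n} \<Longrightarrow> X' c + Y' c = X c + Y c"
    and c: "c \<in> {1..n}"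
  shows "X' c = X c" "Y' c = Y c"
proof -
  have "X' c + V' c = X c + V c"
    using arcs_over_inject[OF assms] arcs_over_inject[OF assms(2,1) P[symmetric] B[symmetric] c]
    by simp
  then show "X' c = X c" "Y' c = Y c"
    using arcs_overD(1,2)[OF assms(1) c] arcs_overD(1,2)[OF assms(2) c] P[OF c] B[OF c]
    by (elim disjE; linarith)+
qed

section \<open>Arcs drawn by the pairing procedure\<close>

lemma partner_in: "b \<noteq> [] \<Longrightarrow> partner x b \<in> set b"
proof (cases "winds x b")
  case False
  then have "{y \<in> set b. y < x} \<noteq> {}" by (auto simp: winds_def)
  then have "Max {y \<in> set b. y < x} \<in> {y \<in> set b. y < x}" by (intro Max_in) auto
  then show ?thesis using False by (simp add: partner_def)
qed (auto simp: partner_def)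

lemma partner_winds: "b \<noteq> [] \<Longrightarrow> winds x b \<Longrightarrow> y \<in> set b \<Longrightarrow> x \<le> y \<and> y \<le> partner x b"
  by (auto simp: partner_def winds_def)

lemma partner_not_winds:
  assumes "\<not> winds x b"
  shows "partner x b < x" "y \<in> set b \<Longrightarrow> y < x \<Longrightarrow> y \<le> partner x b"
proof -
  have "{y \<in> set b. y < x} \<noteq> {}" using assms by (auto simp: winds_def)
  then have "Max {y \<in> set b. y < x} \<in> {y \<in> set b. y < x}" by (intro Max_in) auto
  then show "partner x b < x" using assms by (simp add: partner_def)
  show "y \<in> set b \<Longrightarrow> y < x \<Longrightarrow> y \<le> partner x b"
    using assms by (simp add: partner_def)
qed

lemma pairing_mset:
  "length a \<le> length b \<Longrightarrow> mset (paired a b) + mset (unpaired a b) = mset b"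
proof (induction a b rule: paired.induct)
  case (2 x a b)
  then have "b \<noteq> []" by auto
  then show ?case using 2 partner_in[of b x] by (simp add: length_remove1)
qed simp

lemma length_paired [simp]: "length (paired a b) = length a"
  by (induction a b rule: paired.induct) auto

text \<open>V n + P n counts the arcs that leave box n downwards, over it or out of it, and these
  are the winding pairs. Each new arc starts at the nearest left dot and therefore passes over no
  box containing a left dot. This explains the stronger claim that V vanishes at the box of some
  left dot: such a zero survives the induction, while a zero elsewhere might not.\<close>

lemma pairing_arcs:
  assumes "set a \<subseteq> {1..n}" "set b \<subseteq> {1..n}" "length a \<le> length b" "n \<ge> 1"
  shows "\<exists>V. arcs_over n (cnt a) (cnt b) (cnt (paired a b)) V
     \<and> winding_number a b = V n + cnt (paired a b) n
     \<and> (a = [] \<longrightarrow> V = (\<lambda>_. 0)) \<and> (a \<noteq> [] \<longrightarrow> (\<exists>c\<in>set b. V c = 0))"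
  using assms
proof (induction a b rule: paired.induct)
  case (1 b)
  then show ?case
    by (intro exI[of _ "\<lambda>_. 0"]) (auto simp: arcs_over_def cnt_def)
next
  case (2 x a b)
  define m where "m = partner x b"
  define b' where "b' = remove1 m b"
  have ne: "b \<noteq> []" using 2 by auto
  have m: "m \<in> set b" using ne by (simp add: m_def partner_in)
  have "set b' \<subseteq> set b" by (simp add: b'_def set_remove1_subset)
  then have "set b' \<subseteq> {1..n}" using 2 by auto
  moreover have "length a \<le> length b'" using 2 m by (simp add: b'_def length_remove1)
  ultimately obtain V where V: "arcs_over n (cnt a) (cnt b') (cnt (paired a b')) V"
    "winding_number a b' = V n + cnt (paired a b') n"
    "a = [] \<longrightarrow> V = (\<lambda>_. 0)" "a \<noteq> [] \<longrightarrow> (\<exists>c\<in>set b'. V c = 0)"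
    using 2 unfolding m_def[symmetric] b'_def[symmetric] by auto
  \<comment> \<open>The boxes strictly between \<open>m\<close> and \<open>x\<close> on the way
    down. If a winding pair has \<open>m = x\<close>, its arc goes round once and covers all other
    boxes.\<close>
  define B where "B c \<longleftrightarrow> (if winds x b then c < x \<or> c > m else m < c \<and> c < x)" for c
  define V' where "V' c = V c + of_bool (B c)" for c
  have Bb: "\<not> B c" if "c \<in> set b" for c
    using that partner_winds[OF ne _ that, of x] partner_not_winds(2)[of x b c]
    by (auto simp: B_def m_def)
  have X: "cnt (x # a) c = cnt a c + of_bool (c = x)" for c
    by (simp add: cnt_def)
  have P: "cnt (paired (x # a) b) c = cnt (paired a b') c + of_bool (c = m)" for c
    by (simp add: cnt_def m_def b'_def)
  have Y: "cnt b c = cnt b' c + of_bool (c = m)" for c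
    using m by (auto simp: cnt_def b'_def)
  have mx: "m \<in> {1..n}" "x \<in> {1..n}" using m 2 by auto
  have wm: "winds x b \<Longrightarrow> x \<le> m" and nwm: "\<not> winds x b \<Longrightarrow> m < x"
    using partner_winds[OF ne _ m, of x] partner_not_winds(1)[of x b] by (auto simp: m_def)
  have arc: "of_bool (B c) + of_bool (c = m) = (of_bool (next_box n c = x) + of_bool (B (next_box n c)) :: nat)"
    if "c \<in> {1..n}" for c
    using that mx wm nwm by (cases "winds x b") (auto simp: B_def next_box_def of_bool_def)
  have zero: "\<exists>c\<in>set b. V' c = 0"
  proof (cases "a = []")
    case True
    then show ?thesis using V(3) m Bb[OF m] by (auto simp: V'_def)
  next
    case False
    then obtain c where "c \<in> set b'" "V c = 0" using V(4) by blast
    moreover have "c \<in> set b" using \<open>c \<in> set b'\<close> \<open>set b' \<subseteq> set b\<close> by blast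
    ultimately show ?thesis using Bb by (auto simp: V'_def)
  qed
  have "arcs_over n (cnt (x # a)) (cnt b) (cnt (paired (x # a) b)) V'"
    unfolding arcs_over_def
  proof (intro conjI ballI)
    fix c assume c: "c \<in> {1..n}"
    note 1 = arcs_overD[OF V(1) c]
    show "cnt (paired (x # a) b) c \<le> cnt b c" using 1 unfolding P Y by simp
    have "B c \<Longrightarrow> cnt b c = 0" using Bb[of c] cnt_pos_iff[of b c] by auto
    then show "cnt (paired (x # a) b) c = cnt b c \<or> V' c = 0"
      using 1 unfolding P Y V'_def by (cases "B c") auto
    show "V' c + cnt (paired (x # a) b) c = cnt (x # a) (next_box n c) + V' (next_box n c)"
      using 1(3) arc[OF c] unfolding P X V'_def by linarith
  next
    show "\<exists>c\<in>{1..n}. V' c = 0" using zero 2 by blast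
  qed
  moreover have "winding_number (x # a) b = V' n + cnt (paired (x # a) b) n"
  proof -
    have "winding_number (x # a) b = of_bool (winds x b) + winding_number a b'"
      by (simp add: m_def b'_def)
    moreover have "of_bool (winds x b) = (of_bool (B n) + of_bool (n = m) :: nat)"
      using mx wm nwm by (cases "winds x b") (auto simp: B_def of_bool_def)
    ultimately show ?thesis using V(2) unfolding P V'_def by linarith
  qed
  ultimately show ?case using zero by blast
qed

lemma arcs_overI:
  assumes "\<And>c. c \<in> {1..n} \<Longrightarrow>
      P c \<le> Y c \<and> (P c = Y c \<or> V c = 0) \<and> V c + P c = X (next_box n c) + V (next_box n c)"
    and "z \<in> {1..n}" "V z = 0"
  shows "arcs_over n X Y P V"
  unfolding arcs_over_def
  by (rule conjI, rule ballI, erule assms(1), rule bexI[of _ z], rule assms(3), rule assms(2))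

lemma next_box_close_letter: "i < n \<Longrightarrow> n \<ge> 2 \<Longrightarrow> next_box n (close_letter n i) = open_letter i"
  by (auto simp: next_box_def close_letter_def open_letter_def)

lemma next_box_neq: "n \<ge> 2 \<Longrightarrow> c \<in> {1..n} \<Longrightarrow> next_box n c \<noteq> c"
  by (auto simp: next_box_def)

lemma next_box_inject: "c \<in> {1..n} \<Longrightarrow> d \<in> {1..n} \<Longrightarrow> next_box n c = next_box n d \<longleftrightarrow> c = d"
  by (auto simp: next_box_def split: if_splits)

text \<open>
  A dot of box \<open>c\<close> moves to the next box \<open>o'\<close>. The letters in the names say in which tensor
  factor this happens before and after applying \<open>R\<close>, whose result has counts
  \<open>X + (Y - P)\<close> (left factor) and \<open>P\<close> (right factor).
\<close>

lemma
  fixes X Y P V :: "nat \<Rightarrow> nat"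
  assumes n: "n \<ge> 2" and V: "arcs_over n X Y P V" and c: "c \<in> {1..n}" and o: "o' = next_box n c"
  shows arcs_over_RR: "Y c > X o' \<Longrightarrow> P c > X o' + (Y o' - P o') \<Longrightarrow>
      arcs_over n X (Y(c := Y c - 1, o' := Y o' + 1)) (P(c := P c - 1, o' := P o' + 1))
        (V(o' := V o' - 1)) \<and> V o' > 0 \<and> P c > 0"
    and arcs_over_RL: "Y c > X o' \<Longrightarrow> P c \<le> X o' + (Y o' - P o') \<Longrightarrow>
      arcs_over n X (Y(c := Y c - 1, o' := Y o' + 1)) P V \<and> P c < Y c"
    and arcs_over_LL: "Y c \<le> X o' \<Longrightarrow> X c > 0 \<Longrightarrow>
      arcs_over n (X(c := X c - 1, o' := X o' + 1)) Y P (V(c := V c + 1)) \<and>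
      P c \<le> X o' + (Y o' - P o')"
    and arcs_over_phi: "X c + (Y c - X o') = (X c + (Y c - P c)) + (P c - (X o' + (Y o' - P o'))) \<and>
      (X o' - Y c) + Y o' = ((X o' + (Y o' - P o')) - P c) + P o'"
proof -
  have o': "o' \<in> {1..n}" "o' \<noteq> c" using next_box_range c next_box_neq n o by auto
  note C = arcs_overD[OF V c] and O = arcs_overD[OF V o'(1)]
  have eq: "V c + P c = X o' + V o'" using C(3) o by simp
  have D: "P d \<le> Y d \<and> (P d = Y d \<or> V d = 0) \<and> V d + P d = X (next_box n d) + V (next_box n d)"
    if "d \<in> {1..n}" for d using arcs_overD[OF V that] by blast
  have nxo: "next_box n d = o' \<longleftrightarrow> d = c" if "d \<in> {1..n}" for d
    using next_box_inject[OF that c] o by simp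
  obtain z where z: "z \<in> {1..n}" "V z = 0" using V unfolding arcs_over_def by blast
  obtain p where p: "p \<in> {1..n}" "next_box n p = c"
    by (rule that[of "if c = 1 then n else c - 1"]) (use c in \<open>auto simp: next_box_def\<close>)
  have nxc: "next_box n d = c \<longleftrightarrow> d = p" if "d \<in> {1..n}" for d
    using next_box_inject[OF that p(1)] p(2) by simp
  have no: "next_box n o' \<noteq> o'" "next_box n c \<noteq> c" using next_box_neq n o' c by auto
  show "arcs_over n X (Y(c := Y c - 1, o' := Y o' + 1)) (P(c := P c - 1, o' := P o' + 1))
        (V(o' := V o' - 1)) \<and> V o' > 0 \<and> P c > 0"
    if "Y c > X o'" "P c > X o' + (Y o' - P o')"
  proof -
    have pos: "V o' > 0" "P c > 0" using eq that by linarith+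
    then have "P o' = Y o'" using O by simp
    let ?Y = "Y(c := Y c - 1, o' := Y o' + 1)" and ?P = "P(c := P c - 1, o' := P o' + 1)"
      and ?V = "V(o' := V o' - 1)"
    have "?P d \<le> ?Y d \<and> (?P d = ?Y d \<or> ?V d = 0) \<and> ?V d + ?P d = X (next_box n d) + ?V (next_box n d)"
      if d: "d \<in> {1..n}" for d
    proof -
      consider "d = c" | "d = o'" | "d \<noteq> c" "d \<noteq> o'" by blast
      then show ?thesis
      proof cases
        case 1
        then show ?thesis using C(1,2) eq pos o o'(2) by (elim disjE) simp_all
      next
        case 2
        then show ?thesis using O(3) pos o'(2) no(1) \<open>P o' = Y o'\<close> by simp
      next
        case 3
        then show ?thesis using D[OF d] nxo[OF d] by simp
      qed
    qed
    moreover have "?V z = 0" using z by (cases "z = o'") simp_all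
    ultimately have "arcs_over n X ?Y ?P ?V"
      by (rule arcs_overI[OF _ z(1)])
    then show ?thesis using pos by simp
  qed
  show "arcs_over n X (Y(c := Y c - 1, o' := Y o' + 1)) P V \<and> P c < Y c"
    if "Y c > X o'" "P c \<le> X o' + (Y o' - P o')"
  proof -
    have "P c < Y c"
    proof (rule ccontr)
      assume "\<not> P c < Y c"
      then have "P c = Y c" using C by simp
      then have "V o' > 0" using eq that by linarith
      then show False using O that \<open>P c = Y c\<close> by auto
    qed
    moreover from this have "V c = 0" using C by auto
    moreover have "V o' = 0"
      using O(1,2) eq that \<open>V c = 0\<close> by (elim disjE) linarith+
    moreover have "P d \<le> (Y(c := Y c - 1, o' := Y o' + 1)) d \<and>
        (P d = (Y(c := Y c - 1, o' := Y o' + 1)) d \<or> V d = 0) \<and>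
        V d + P d = X (next_box n d) + V (next_box n d)" if "d \<in> {1..n}" for d
      using D[OF that] calculation o'(2) by (cases "d = c"; cases "d = o'") simp_all
    ultimately show ?thesis
      using arcs_overI[of n P "Y(c := Y c - 1, o' := Y o' + 1)" V X, OF _ z] by blast
  qed
  show "arcs_over n (X(c := X c - 1, o' := X o' + 1)) Y P (V(c := V c + 1)) \<and>
      P c \<le> X o' + (Y o' - P o')" if "Y c \<le> X o'" "X c > 0"
  proof -
    have 1: "P c = Y c" using C eq that by auto
    \<comment> \<open>V is about to grow at \<open>c\<close>, so the last condition of
      \<open>arcs_over\<close> needs a zero elsewhere. If \<open>c\<close> itself was the zero, the
      balance P c = X o' + V o' together with P c = Y c \<le> X o' makes \<open>o'\<close> another
      one.\<close>
    have "\<exists>z\<in>{1..n}. z \<noteq> c \<and> V z = 0"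
    proof (cases "z = c")
      case True
      then have "V o' = 0" using z eq 1 that by simp
      then show ?thesis using o' by blast
    qed (use z in blast)
    then obtain z where z: "z \<in> {1..n}" "V z = 0" "z \<noteq> c" by blast
    let ?X = "X(c := X c - 1, o' := X o' + 1)" and ?V = "V(c := V c + 1)"
    have "P d \<le> Y d \<and> (P d = Y d \<or> ?V d = 0) \<and> ?V d + P d = ?X (next_box n d) + ?V (next_box n d)"
      if d: "d \<in> {1..n}" for d
    proof -
      consider "d = c" | "d \<noteq> c" "next_box n d = c" | "d \<noteq> c" "next_box n d \<noteq> c" by blast
      then show ?thesis
      proof cases
        case 1
        then show ?thesis using eq o o'(2) \<open>P c = Y c\<close> by simp
      next
        case 2
        then show ?thesis using D[OF d] nxo[OF d] o'(2) \<open>X c > 0\<close> by simp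
      next
        case 3
        then show ?thesis using D[OF d] nxo[OF d] by simp
      qed
    qed
    moreover have "?V z = 0" using z by simp
    ultimately have "arcs_over n ?X Y P ?V"
      by (rule arcs_overI[OF _ z(1)])
    then show ?thesis using 1 that by simp
  qed
  show "X c + (Y c - X o') = (X c + (Y c - P c)) + (P c - (X o' + (Y o' - P o'))) \<and>
      (X o' - Y c) + Y o' = ((X o' + (Y o' - P o')) - P c) + P o'"
    using C(1,2) O(1,2) eq by (elim disjE) auto
qed

section \<open>The combinatorial R-matrix commutes with the crystal operators\<close>

lemma
  assumes "sorted a" "sorted b" "i < n" "n \<ge> 2"
  shows f_op_pair: "f_op n i [a, b] =
      (if cnt b (close_letter n i) > cnt a (open_letter i)
       then Some [a, upd (close_letter n i) (open_letter i) b]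
       else if cnt a (close_letter n i) > 0
       then Some [upd (close_letter n i) (open_letter i) a, b] else None)"
    and phi_pair: "phi n i [a, b] =
      cnt a (close_letter n i) + (cnt b (close_letter n i) - cnt a (open_letter i))"
    and eps_pair: "eps n i [a, b] =
      (cnt a (open_letter i) - cnt b (close_letter n i)) + cnt b (open_letter i)"
  using assms by (auto simp: f_op_Cons phi_Cons eps_Cons)

lemma pos_pair:
  assumes "sorted b" "i < n" "n \<ge> 2"
  shows "pos n i [a, b] = (if cnt b (close_letter n i) > cnt a (open_letter i) then 1
    else if cnt a (close_letter n i) > 0 then 2 else 0)"
  using assms by (auto simp: phi_Cons)

text \<open>R and W as one relation between multiplicities: \<open>d\<close> collects the paired
  dots of \<open>b\<close>, and \<open>w\<close> counts the arcs from box n to box 1. No order of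
  pairing is mentioned, so the relation can be carried along \<open>f_op\<close> by adjusting
  V.\<close>

definition exchanged :: "nat \<Rightarrow> nat list \<Rightarrow> nat list \<Rightarrow> nat list \<Rightarrow> nat list \<Rightarrow> nat \<Rightarrow> bool" where
  "exchanged n a b c d w \<longleftrightarrow> valid n [a, b] \<and> valid n [c, d] \<and> length d = length a \<and>
     mset c + mset d = mset a + mset b \<and>
     (\<exists>V. arcs_over n (cnt a) (cnt b) (cnt d) V \<and> w = V n + cnt d n)"

lemma sorted_cnt_eqI:
  assumes "sorted a" "sorted b" "set a \<subseteq> {1..n}" "set b \<subseteq> {1..n}"
    and "\<And>x. x \<in> {1..n} \<Longrightarrow> cnt a x = cnt b x"
  shows "a = b"
proof -
  have "count (mset a) x = count (mset b) x" for x
  proof (cases "x \<in> {1..n}")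
    case False
    then have "x \<notin> set a" "x \<notin> set b" using assms(3,4) by blast+
    then have "count (mset a) x = 0" "count (mset b) x = 0" by (simp_all add: count_eq_zero_iff)
    then show ?thesis by metis
  qed (use assms(5) in \<open>simp add: cnt_def\<close>)
  then have "mset a = mset b" by (rule multiset_eqI)
  then show ?thesis using assms(1,2) by (metis properties_for_sort)
qed

lemma exchanged_length: "exchanged n a b c d w \<Longrightarrow> length c = length b"
  unfolding exchanged_def by (metis add.commute add_right_cancel length_append mset_append size_mset)

lemma exchanged_cnt:
  assumes "exchanged n a b c d w" shows "cnt c x + cnt d x = cnt a x + cnt b x"
proof -
  have "count (mset c + mset d) x = count (mset a + mset b) x"
    using assms unfolding exchanged_def by metis
  then show ?thesis by (simp add: cnt_def)
qed

lemma exchanged_unique: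
  assumes "exchanged n a b c d w" "exchanged n a b c' d' w'" "n \<ge> 1"
  shows "c = c'" "d = d'" "w = w'"
proof -
  obtain V where V: "arcs_over n (cnt a) (cnt b) (cnt d) V" "w = V n + cnt d n"
    using assms(1) unfolding exchanged_def by blast
  obtain V' where V': "arcs_over n (cnt a) (cnt b) (cnt d') V'" "w' = V' n + cnt d' n"
    using assms(2) unfolding exchanged_def by blast
  have D: "cnt d' x = cnt d x" if "x \<in> {1..n}" for x
    using arcs_over_unique(1)[OF V(1) V'(1) that] .
  have "V' n = V n" using arcs_over_unique(2)[OF V(1) V'(1), of n] assms(3) by simp
  then show "w = w'" using V(2) V'(2) D[of n] assms(3) by simp
  have v: "valid n [c, d]" "valid n [c', d']" using assms unfolding exchanged_def by auto
  then show "d = d'" using D by (intro sorted_cnt_eqI[of d d' n]) auto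
  have "cnt c x = cnt c' x" if "x \<in> {1..n}" for x
    using exchanged_cnt[OF assms(1), of x] exchanged_cnt[OF assms(2), of x] D[OF that] by linarith
  then show "c = c'" using v by (intro sorted_cnt_eqI[of c c' n]) auto
qed

lemma exchanged_inject:
  assumes "exchanged n a b c d w" "exchanged n a' b' c d w'"
  shows "a = a'" "b = b'"
proof -
  obtain V where V: "arcs_over n (cnt a) (cnt b) (cnt d) V"
    using assms(1) unfolding exchanged_def by blast
  obtain V' where V': "arcs_over n (cnt a') (cnt b') (cnt d) V'"
    using assms(2) unfolding exchanged_def by blast
  have B: "cnt a' x + cnt b' x = cnt a x + cnt b x" for x
    using exchanged_cnt[OF assms(1), of x] exchanged_cnt[OF assms(2), of x] by linarith
  have v: "valid n [a, b]" "valid n [a', b']" using assms unfolding exchanged_def by auto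
  have "cnt a' x = cnt a x" "cnt b' x = cnt b x" if "x \<in> {1..n}" for x
    using arcs_over_inject_eq[OF V V' _ B that] by simp_all
  then show "a = a'" "b = b'" using v by (auto intro!: sorted_cnt_eqI[of _ _ n])
qed

lemma exchanged_R_short:
  assumes "valid n [a, b]" "length a \<le> length b" "n \<ge> 1"
  shows "\<exists>c d. R_short (a, b) = (c, d) \<and> exchanged n a b c d (winding_number a b)"
proof -
  obtain V where V: "arcs_over n (cnt a) (cnt b) (cnt (paired a b)) V"
    "winding_number a b = V n + cnt (paired a b) n"
    using pairing_arcs[of a n b] assms by auto
  have m: "mset (paired a b) + mset (unpaired a b) = mset b"
    by (rule pairing_mset[OF assms(2)])
  let ?c = "sort (a @ unpaired a b)" and ?d = "sort (paired a b)"
  have "set (paired a b) \<union> set (unpaired a b) = set b"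
    using arg_cong[OF m, of set_mset] by simp
  then have "valid n [?c, ?d]" using assms(1) by auto
  moreover have "mset ?c + mset ?d = mset a + mset b"
    by (simp add: m[symmetric])
  moreover have "cnt ?d = cnt (paired a b)"
    by (simp add: cnt_def fun_eq_iff)
  ultimately have "exchanged n a b ?c ?d (winding_number a b)"
    unfolding exchanged_def using assms(1) V by (intro conjI exI[of _ V]) (simp_all only: length_sort length_paired)
  then show ?thesis by (simp add: R_short_def)
qed

lemma finite_words: "finite (words n k)"
  using finite_lists_length_eq[of "{1..n}" k] by (rule rev_finite_subset) (auto simp: words_def)

lemma valid_pair_words: "valid n [a, b] \<longleftrightarrow> (a, b) \<in> words n (length a) \<times> words n (length b)"
  by (auto simp: words_def)

text \<open>Surjectivity comes from counting: the map is injective, and source and target are finite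
  of the same size. This gives meaning to the inverse that defines R for a longer left word.\<close>

lemma R_short_bij:
  assumes "k \<le> l" "n \<ge> 1"
  shows "bij_betw R_short (words n k \<times> words n l) (words n l \<times> words n k)"
proof -
  have *: "\<exists>w. exchanged n (fst p) (snd p) (fst (R_short p)) (snd (R_short p)) w"
    if "p \<in> words n k \<times> words n l" for p
    using exchanged_R_short[of n "fst p" "snd p"] that assms by (cases p) (auto simp: words_def)
  have inj: "inj_on R_short (words n k \<times> words n l)"
    using * exchanged_inject by (intro inj_onI prod_eqI) metis+
  have "R_short ` (words n k \<times> words n l) \<subseteq> words n l \<times> words n k"
  proof
    fix q assume "q \<in> R_short ` (words n k \<times> words n l)"
    then obtain p where p: "p \<in> words n k \<times> words n l" "q = R_short p" by blast
    from *[OF p(1)] obtain w where "exchanged n (fst p) (snd p) (fst q) (snd q) w" unfolding p by blast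
    then show "q \<in> words n l \<times> words n k"
      using exchanged_length[of n "fst p" "snd p" "fst q" "snd q" w] p(1)
      by (cases q) (auto simp: exchanged_def words_def)
  qed
  moreover have "card (R_short ` (words n k \<times> words n l)) = card (words n l \<times> words n k)"
    by (simp add: card_image[OF inj] card_cartesian_product)
  ultimately have "R_short ` (words n k \<times> words n l) = words n l \<times> words n k"
    by (intro card_subset_eq) (simp_all add: finite_words)
  with inj show ?thesis by (rule bij_betw_imageI)
qed

lemma exchanged_surj:
  assumes "valid n [c, d]" "length d \<le> length c" "n \<ge> 1"
  shows "\<exists>a b. R_short (a, b) = (c, d) \<and> length a = length d \<and> length b = length c \<and>
     exchanged n a b c d (winding_number a b)"
proof -
  have "(c, d) \<in> R_short ` (words n (length d) \<times> words n (length c))"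
    using R_short_bij[OF assms(2,3)] assms(1) unfolding bij_betw_def valid_pair_words by simp
  then obtain a b where ab: "(a, b) \<in> words n (length d) \<times> words n (length c)" "R_short (a, b) = (c, d)"
    by auto
  then have "valid n [a, b]" "length a = length d" "length b = length c" by (auto simp: words_def)
  then show ?thesis using exchanged_R_short[of n a b] assms ab(2) by auto
qed

lemma exchanged_phi_eps:
  assumes "exchanged n a b c d w" "i < n" "n \<ge> 2"
  shows "phi n i [c, d] = phi n i [a, b]" "eps n i [c, d] = eps n i [a, b]"
proof -
  obtain V where V: "arcs_over n (cnt a) (cnt b) (cnt d) V"
    using assms(1) unfolding exchanged_def by blast
  have s: "sorted a" "sorted b" "sorted c" "sorted d" using assms unfolding exchanged_def by auto
  have co: "close_letter n i \<in> {1..n}" "open_letter i \<in> {1..n}"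
    "open_letter i = next_box n (close_letter n i)"
    using letters_le[OF assms(2,3)] next_box_close_letter[OF assms(2,3)] by auto
  have "cnt c x = cnt a x + (cnt b x - cnt d x)" if "x \<in> {1..n}" for x
    using exchanged_cnt[OF assms(1), of x] arcs_overD(1)[OF V that] by linarith
  then show "phi n i [c, d] = phi n i [a, b]" "eps n i [c, d] = eps n i [a, b]"
    using arcs_over_phi[OF assms(3) V co(1,3)] co(1,2) s assms
    by (simp_all add: phi_pair eps_pair)
qed

text \<open>The dot moves in the right factor before and after R, or in the right and then the left
  one, or in the left one both times; the fourth combination cannot occur. The number w = V n + P n
  changes only if the dot leaves box n, that is for i = 0: it drops in the first case and grows in
  the third. If the dot enters box n in the first case, V n and P n change by opposite
  amounts.\<close>

lemma exchanged_f_op: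
  assumes "exchanged n a b c d w" "i < n" "n \<ge> 2" "f_op n i [a, b] = Some [a', b']"
  shows "\<exists>c' d' w'. f_op n i [c, d] = Some [c', d'] \<and> exchanged n a' b' c' d' w' \<and>
    (int w' = int w + (if i = 0 then of_bool (pos n i [a, b] = 2) - of_bool (pos n i [c, d] = 1) else 0))"
proof -
  define x where "x = close_letter n i"
  define y where "y = open_letter i"
  obtain V where V: "arcs_over n (cnt a) (cnt b) (cnt d) V" "w = V n + cnt d n"
    using assms(1) unfolding exchanged_def by blast
  have v: "valid n [a, b]" "valid n [c, d]" and l: "length d = length a"
    and m: "mset c + mset d = mset a + mset b" using assms(1) unfolding exchanged_def by auto
  then have s: "sorted a" "sorted b" "sorted c" "sorted d" by auto
  have xy: "x \<in> {1..n}" "y \<in> {1..n}" "x \<noteq> y" "y = next_box n x"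
    using letters_le[OF assms(2,3)] next_box_close_letter[OF assms(2,3)] by (auto simp: x_def y_def)
  have xn: "x = n \<longleftrightarrow> i = 0" using assms(2) by (auto simp: x_def close_letter_def)
  have c: "cnt c z = cnt a z + (cnt b z - cnt d z)" if "z \<in> {1..n}" for z
    using exchanged_cnt[OF assms(1), of z] arcs_overD(1)[OF V(1) that] by linarith
  note f = f_op_pair[OF _ _ assms(2,3), folded x_def y_def]
  note p = pos_pair[OF _ assms(2,3), folded x_def y_def]
  have up: "cnt (upd x y h) = (cnt h)(x := cnt h x - 1, y := cnt h y + 1)" if "cnt h x > 0" for h
    using that xy(3) by (auto simp: cnt_upd cnt_pos_iff fun_eq_iff)
  have ml: "mset (upd x y h) + mset k = add_mset y (mset h + mset k - {#x#})"
    "mset k + mset (upd x y h) = add_mset y (mset k + mset h - {#x#})"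
    "length (upd x y h) = length h"
    "set h \<subseteq> {1..n} \<Longrightarrow> set (upd x y h) \<subseteq> {1..n}"
    if "cnt h x > 0" for h k
    using that set_upd_range[OF assms(2,3) _ xy(2)]
    by (auto simp: mset_upd cnt_pos_iff length_upd[OF assms(2,3)] ac_simps
        simp del: atLeastAtMost_iff One_nat_def)
  show ?thesis
  proof (cases "cnt b x > cnt a y")
    case True
    then have ab': "a' = a" "b' = upd x y b" using assms(4) s by (auto simp: f)
    have b0: "cnt b x > 0" using True by simp
    show ?thesis
    proof (cases "cnt d x > cnt c y")
      case True2: True
      have RR: "arcs_over n (cnt a) (cnt (upd x y b)) (cnt (upd x y d)) (V(y := V y - 1))"
        "V y > 0" "cnt d x > 0"
        using arcs_over_RR[OF assms(3) V(1) xy(1,4)] True True2 c[OF xy(2)] up b0 by auto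
      have "exchanged n a' b' c (upd x y d) ((V(y := V y - 1)) n + cnt (upd x y d) n)"
        unfolding exchanged_def ab' using RR v l m ml b0
        by (auto simp del: atLeastAtMost_iff One_nat_def fun_upd_apply intro!: exI[of _ "V(y := V y - 1)"])
      moreover have "f_op n i [c, d] = Some [c, upd x y d]" using True2 s by (simp add: f)
      moreover have "int ((V(y := V y - 1)) n + cnt (upd x y d) n) = int w +
          (if i = 0 then of_bool (pos n i [a, b] = 2) - of_bool (pos n i [c, d] = 1) else 0)"
        using RR(2,3) xy(3) xn s True True2 unfolding V(2) up[OF RR(3)] p[OF s(2)] p[OF s(4)]
        by (auto simp: of_nat_diff)
      ultimately show ?thesis by blast
    next
      case False2: False
      have RL: "arcs_over n (cnt a) (cnt (upd x y b)) (cnt d) V" "cnt d x < cnt b x"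
        using arcs_over_RL[OF assms(3) V(1) xy(1,4)] True False2 c[OF xy(2)] up b0 by auto
      have c0: "cnt c x > 0" using c[OF xy(1)] RL(2) by simp
      have "exchanged n a' b' (upd x y c) d w"
        unfolding exchanged_def ab' using RL v l m ml b0 c0 V(2)
        by (auto simp del: atLeastAtMost_iff One_nat_def intro!: exI[of _ "V"])
      moreover have "f_op n i [c, d] = Some [upd x y c, d]" using False2 s c0 by (simp add: f)
      moreover have "int w = int w +
          (if i = 0 then of_bool (pos n i [a, b] = 2) - of_bool (pos n i [c, d] = 1) else 0)"
        using s True False2 unfolding p[OF s(2)] p[OF s(4)] by auto
      ultimately show ?thesis by blast
    qed
  next
    case False
    then have a0: "cnt a x > 0" and ab': "a' = upd x y a" "b' = b"
      using assms(4) s by (auto simp: f split: if_splits)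
    have LL: "arcs_over n (cnt (upd x y a)) (cnt b) (cnt d) (V(x := V x + 1))" "\<not> cnt d x > cnt c y"
      using arcs_over_LL[OF assms(3) V(1) xy(1,4)] False c[OF xy(2)] up a0 by auto
    have c0: "cnt c x > 0" using c[OF xy(1)] a0 by simp
    have "exchanged n a' b' (upd x y c) d ((V(x := V x + 1)) n + cnt d n)"
      unfolding exchanged_def ab' using LL v l m ml a0 c0
      by (auto simp del: atLeastAtMost_iff One_nat_def fun_upd_apply intro!: exI[of _ "V(x := V x + 1)"])
    moreover have "f_op n i [c, d] = Some [upd x y c, d]" using LL(2) s c0 by (simp add: f)
    moreover have "int ((V(x := V x + 1)) n + cnt d n) = int w +
        (if i = 0 then of_bool (pos n i [a, b] = 2) - of_bool (pos n i [c, d] = 1) else 0)"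
      using s False LL(2) a0 c0 xn unfolding p[OF s(2)] p[OF s(4)] V(2) by auto
    ultimately show ?thesis by blast
  qed
qed

declare pos.simps [simp del]

text \<open>The inverse function in \<open>R_matrix\<close> becomes an exchange of arguments, so
  that facts about a longer left word are obtained by reading \<open>exchanged\<close>
  backwards.\<close>

definition R_related :: "nat \<Rightarrow> nat list \<Rightarrow> nat list \<Rightarrow> nat list \<Rightarrow> nat list \<Rightarrow> nat \<Rightarrow> bool" where
  "R_related n a b c d w \<longleftrightarrow> (if length a \<le> length b then exchanged n a b c d w else exchanged n c d a b w)"

lemma R_related_basic:
  assumes "R_related n a b c d w"
  shows "valid n [a, b]" "valid n [c, d]" "length c = length b" "length d = length a"
    "mset c + mset d = mset a + mset b"
proof -
  have "exchanged n a b c d w \<or> exchanged n c d a b w" using assms unfolding R_related_def by metis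
  moreover have "length c = length b"
    using calculation exchanged_length[of n a b c d w] unfolding exchanged_def by metis
  moreover have "length d = length a"
    using calculation exchanged_length[of n c d a b w] unfolding exchanged_def by metis
  ultimately show "valid n [a, b]" "valid n [c, d]" "length c = length b" "length d = length a"
    "mset c + mset d = mset a + mset b"
    unfolding exchanged_def by metis+
qed

lemma R_related_surj:
  assumes "valid n [c, d]" "n \<ge> 1"
  shows "\<exists>a b w. R_related n a b c d w"
proof (cases "length d \<le> length c")
  case True
  then obtain a b w where "exchanged n a b c d w" "length a = length d" "length b = length c"
    using exchanged_surj assms by blast
  then show ?thesis using True unfolding R_related_def by metis
next
  case False
  then obtain a b w where e: "exchanged n c d a b w"
    using exchanged_R_short[of n c d] assms by auto
  have "length b = length c" using e unfolding exchanged_def by blast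
  then have "\<not> length a \<le> length b"
    using False exchanged_length[OF e] by simp
  then have "R_related n a b c d w" using e unfolding R_related_def by simp
  then show ?thesis by blast
qed

lemma R_related_inject:
  assumes "R_related n a b c d w" "R_related n a' b' c d w'" "n \<ge> 1"
  shows "a = a'" "b = b'"
proof -
  have l: "length a \<le> length b \<longleftrightarrow> length a' \<le> length b'"
    using R_related_basic(3,4)[OF assms(1)] R_related_basic(3,4)[OF assms(2)] by simp
  have "a = a' \<and> b = b'"
  proof (cases "length a \<le> length b")
    case True
    then have "exchanged n a b c d w" "exchanged n a' b' c d w'"
      using assms l unfolding R_related_def by simp_all
    then show ?thesis by (auto dest: exchanged_inject)
  next
    case False
    then have "exchanged n c d a b w" "exchanged n c d a' b' w'"
      using assms l unfolding R_related_def by simp_all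
    then show ?thesis using exchanged_unique[OF _ _ assms(3)] by blast
  qed
  then show "a = a'" "b = b'" by auto
qed

lemma R_related_R_matrix:
  assumes "R_related n a b c d w" "n \<ge> 1"
  shows "R_matrix n (a, b) = (c, d)" "W n (a, b) = w"
proof -
  have "R_matrix n (a, b) = (c, d) \<and> W n (a, b) = w"
  proof (cases "length a \<le> length b")
    case True
    then have e: "exchanged n a b c d w" using assms(1) unfolding R_related_def by simp
    then have "valid n [a, b]" unfolding exchanged_def by blast
    from exchanged_R_short[OF this True assms(2)] obtain c' d' where
      c'd': "R_short (a, b) = (c', d')" "exchanged n a b c' d' (winding_number a b)" by blast
    then show ?thesis using exchanged_unique[OF e c'd'(2) assms(2)] True
      by (simp add: R_matrix_def W_def)
  next
    case False
    then have e: "exchanged n c d a b w" using assms(1) unfolding R_related_def by simp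
    then have v: "valid n [c, d]" unfolding exchanged_def by blast
    have l: "length c = length b" "length d = length a" using R_related_basic[OF assms(1)] by auto
    then have "length c \<le> length d" using False by simp
    from exchanged_R_short[OF v this assms(2)] obtain a' b' where
      a'b': "R_short (c, d) = (a', b')" "exchanged n c d a' b' (winding_number c d)" by blast
    then have ab: "a' = a" "b' = b" "winding_number c d = w"
      using exchanged_unique[OF e a'b'(2) assms(2)] by auto
    have "inj_on R_short (words n (length c) \<times> words n (length d))"
      using R_short_bij[OF \<open>length c \<le> length d\<close> assms(2)] by (simp add: bij_betw_def)
    moreover have "(c, d) \<in> words n (length c) \<times> words n (length d)"
      using v by (simp only: valid_pair_words)
    ultimately have "inv_into (words n (length c) \<times> words n (length d)) R_short (R_short (c, d)) = (c, d)"
      by (rule inv_into_f_f)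
    then have "R_matrix n (a, b) = (c, d)"
      using False a'b'(1) ab l by (simp add: R_matrix_def)
    then show ?thesis using False ab by (simp add: W_def)
  qed
  then show "R_matrix n (a, b) = (c, d)" "W n (a, b) = w" by auto
qed

lemma R_related_R:
  assumes "valid n [a, b]" "n \<ge> 1" "R_matrix n (a, b) = (c, d)"
  shows "R_related n a b c d (W n (a, b))"
proof -
  have "\<exists>c d w. R_related n a b c d w"
  proof (cases "length a \<le> length b")
    case True
    then show ?thesis using exchanged_R_short[OF assms(1) _ assms(2)] unfolding R_related_def by auto
  next
    case False
    then show ?thesis using exchanged_surj[OF assms(1) _ assms(2)] unfolding R_related_def by (meson nat_le_linear)
  qed
  then show ?thesis using R_related_R_matrix[OF _ assms(2)] assms(3) by auto
qed

lemma R_related_phi_eps: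
  assumes "R_related n a b c d w" "i < n" "n \<ge> 2"
  shows "phi n i [c, d] = phi n i [a, b]" "eps n i [c, d] = eps n i [a, b]"
  using exchanged_phi_eps[of n a b c d w i] exchanged_phi_eps[of n c d a b w i] assms
  unfolding R_related_def by (auto split: if_splits)

lemma f_op_pairE:
  assumes "i < n" "n \<ge> 2" "valid n [a, b]" "phi n i [a, b] > 0"
  obtains a' b' where "f_op n i [a, b] = Some [a', b']" "length a' = length a" "length b' = length b"
proof -
  from assms(4) obtain H where H: "f_op n i [a, b] = Some H"
    using f_op_None_iff[of n i "[a, b]"] by auto
  then have "map length H = map length [a, b]" using f_op_valid[OF assms(1,2,3)] by blast
  then show ?thesis using that H by (auto simp: map_eq_Cons_conv)
qed

lemma R_related_f_op:
  assumes "R_related n a b c d w" "i < n" "n \<ge> 2" "f_op n i [a, b] = Some [a', b']"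
  shows "\<exists>c' d' w'. f_op n i [c, d] = Some [c', d'] \<and> R_related n a' b' c' d' w' \<and>
    (int w' = int w + (if i = 0 then of_bool (pos n i [a, b] = 2) - of_bool (pos n i [c, d] = 1) else 0))"
proof -
  note v = R_related_basic[OF assms(1)]
  have l: "length a' = length a" "length b' = length b"
    using f_op_valid[OF assms(2,3) v(1) assms(4)] by auto
  show ?thesis
  proof (cases "length a \<le> length b")
    case True
    then show ?thesis
      using exchanged_f_op[OF _ assms(2,3,4), of c d w] assms(1) l unfolding R_related_def by auto
  next
    case False
    then have e: "exchanged n c d a b w" using assms(1) unfolding R_related_def by simp
    have f: "phi n i [a, b] > 0" using f_op_None_iff[of n i "[a, b]"] assms(4) by simp
    then have "phi n i [c, d] > 0" using R_related_phi_eps[OF assms(1-3)] by simp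
    then obtain c' d' where c'd': "f_op n i [c, d] = Some [c', d']"
      using f_op_pairE[OF assms(2,3) v(2)] by blast
    obtain w' where w': "exchanged n c' d' a' b' w'"
      "int w' = int w + (if i = 0 then of_bool (pos n i [c, d] = 2) - of_bool (pos n i [a, b] = 1) else 0)"
      using exchanged_f_op[OF e assms(2,3) c'd'] assms(4) by auto
    \<comment> \<open>Reading backwards exchanges the positions p before and q after R. As both are
      1 or 2, [q = 2] - [p = 1] equals [p = 2] - [q = 1], and the formula keeps its form.\<close>
    have "pos n i [x, y] = 1 \<or> pos n i [x, y] = 2"
      if "valid n [x, y]" "phi n i [x, y] > 0" for x y
      using pos_pos_iff[OF assms(2,3) that(1)] pos_le[OF assms(2,3), of "[x, y]"] that(2)
      by simp linarith
    from this[OF v(1) f] this[OF v(2) \<open>phi n i [c, d] > 0\<close>]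
    have "int w' = int w + (if i = 0 then of_bool (pos n i [a, b] = 2) - of_bool (pos n i [c, d] = 1) else 0)"
      using w'(2) by (elim disjE; cases "i = 0") simp_all
    moreover have "R_related n a' b' c' d' w'" using w'(1) False l unfolding R_related_def by simp
    ultimately show ?thesis using c'd' by blast
  qed
qed

section \<open>The operators sigma_i on whole tensors\<close>

lemma sigma_split:
  assumes "length B = i - 1" "i \<ge> 1"
  shows "sigma n i (A @ a # b # B) = (case R_matrix n (a, b) of (c, d) \<Rightarrow> A @ c # d # B)"
    "W_at n i (A @ a # b # B) = W n (a, b)"
proof -
  have 1: "length (A @ a # b # B) - (i + 1) = length A" "length (A @ a # b # B) - i = Suc (length A)"
    using assms by auto
  show "sigma n i (A @ a # b # B) = (case R_matrix n (a, b) of (c, d) \<Rightarrow> A @ c # d # B)"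
    unfolding sigma_def factor_def 1
    by (auto simp: nth_append list_update_append split: prod.split)
  show "W_at n i (A @ a # b # B) = W n (a, b)"
    unfolding W_at_def factor_def 1 by (simp add: nth_append)
qed

lemma list_split_at:
  assumes "1 \<le> i" "i < length H"
  obtains A a b B where "H = A @ a # b # B" "length B = i - 1"
proof -
  let ?k = "length H - (i + 1)"
  have "H = take ?k H @ drop ?k H" by simp
  moreover have "drop ?k H = H ! ?k # H ! Suc ?k # drop (Suc (Suc ?k)) H"
    using assms by (simp add: Cons_nth_drop_Suc)
  ultimately have "H = take ?k H @ H ! ?k # H ! Suc ?k # drop (Suc (Suc ?k)) H" by metis
  then show ?thesis using that assms by fastforce
qed

lemma sigma_cases:
  assumes "1 \<le> i" "i < length H" "valid n H" "n \<ge> 1"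
  obtains A a b c d B where "H = A @ [a, b] @ B" "sigma n i H = A @ [c, d] @ B"
    "length B = i - 1" "R_related n a b c d (W_at n i H)" "valid n A" "valid n [a, b]" "valid n [c, d]" "valid n B"
proof -
  obtain A a b B where H: "H = A @ a # b # B" "length B = i - 1"
    using list_split_at assms by blast
  obtain c d where cd: "R_matrix n (a, b) = (c, d)" by fastforce
  have v: "valid n [a, b]" using assms H by simp
  have R: "R_related n a b c d (W_at n i H)"
    using R_related_R[OF v assms(4) cd] sigma_split(2)[OF H(2) assms(1)] H(1) by simp
  show ?thesis
    by (rule that[of A a b B c d])
      (use H cd R sigma_split(1)[OF H(2) assms(1), of n A a b] R_related_basic(2)[OF R] assms in auto)
qed

lemma sigma_basic:
  assumes "1 \<le> i" "i < length H" "valid n H" "n \<ge> 1"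
  shows "valid n (sigma n i H)" "length (sigma n i H) = length H"
    "mset (map length (sigma n i H)) = mset (map length H)"
    "mset (concat (sigma n i H)) = mset (concat H)"
    "map length (sigma n i H) =
      (map length H)[length H - (i + 1) := map length H ! (length H - i),
                     length H - i := map length H ! (length H - (i + 1))]"
proof -
  obtain A a b c d B where H: "H = A @ [a, b] @ B" "sigma n i H = A @ [c, d] @ B"
    "length B = i - 1" "R_related n a b c d (W_at n i H)" "valid n A" "valid n [a, b]" "valid n [c, d]" "valid n B"
    using sigma_cases[OF assms] .
  note R = R_related_basic[OF H(4)]
  show "valid n (sigma n i H)" using H by simp
  show "length (sigma n i H) = length H" using H by simp
  show "mset (map length (sigma n i H)) = mset (map length H)" using H(1,2) R by simp
  show "mset (concat (sigma n i H)) = mset (concat H)" using H(1,2) R by simp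
  have k: "length H - (i + 1) = length A" "length H - i = Suc (length A)" using H(1,3) assms(1) by auto
  show "map length (sigma n i H) =
      (map length H)[length H - (i + 1) := map length H ! (length H - i),
                     length H - i := map length H ! (length H - (i + 1))]"
    unfolding k H(2) unfolding H(1) using R
    by (simp add: nth_append list_update_append)
qed

lemma sigma_inject:
  assumes "1 \<le> i" "i < length H" "length H = length H'" "valid n H" "valid n H'" "n \<ge> 1"
    "sigma n i H = sigma n i H'"
  shows "H = H'"
proof -
  obtain A a b c d B where H: "H = A @ [a, b] @ B" "sigma n i H = A @ [c, d] @ B"
    "length B = i - 1" "R_related n a b c d (W_at n i H)"
    using sigma_cases[OF assms(1,2,4,6)] by metis
  obtain A' a' b' c' d' B' where H': "H' = A' @ [a', b'] @ B'" "sigma n i H' = A' @ [c', d'] @ B'"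
    "length B' = i - 1" "R_related n a' b' c' d' (W_at n i H')"
    using sigma_cases[of i H' n] assms by metis
  have "A @ [c, d] @ B = A' @ [c', d'] @ B'" using H H' assms(7) by metis
  moreover have "length A = length A'" using H(1,3) H'(1,3) assms(3) by simp
  ultimately have "A = A'" "c = c'" "d = d'" "B = B'" by auto
  then show ?thesis using R_related_inject[OF H(4), of a' b' "W_at n i H'"] H'(4) H(1) H'(1) assms(6) by simp
qed

lemma sigma_surj:
  assumes "1 \<le> i" "i < length H" "valid n H" "n \<ge> 1"
  shows "\<exists>H0. valid n H0 \<and> length H0 = length H \<and> sigma n i H0 = H"
proof -
  obtain A c d B where H: "H = A @ c # d # B" "length B = i - 1"
    using list_split_at assms by blast
  then have "valid n [c, d]" using assms by simp
  then obtain a b w where R: "R_related n a b c d w" using R_related_surj assms(4) by blast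
  show ?thesis
    using R_related_R_matrix(1)[OF R assms(4)] R_related_basic(1)[OF R] assms H
    by (intro exI[of _ "A @ a # b # B"]) (simp add: sigma_split)
qed

text \<open>R preserves \<open>phi\<close> and \<open>eps\<close> of the pair, so by the product
  rule \<open>f_op\<close> acts in the same block (left of the pair, in it, right of it) before and
  after sigma_i. Only an action inside the pair can change W_i. The block to the right has length i
  - 1, so the pair occupies positions i and i + 1.\<close>

lemma sigma_f_op:
  assumes "1 \<le> i" "i < length H" "valid n H" "n \<ge> 2" "k < n"
  shows "f_op n k (sigma n i H) = map_option (sigma n i) (f_op n k H)"
    "phi n k (sigma n i H) = phi n k H"
    "f_op n k H = Some H' \<Longrightarrow> int (W_at n i H') = int (W_at n i H) +
      (if k = 0 then of_bool (pos n k H = i + 1) - of_bool (pos n k (sigma n i H) = i) else 0)"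
proof -
  have n1: "n \<ge> 1" using assms by simp
  obtain A a b c d B where H: "H = A @ [a, b] @ B" "sigma n i H = A @ [c, d] @ B"
    "length B = i - 1" "R_related n a b c d (W_at n i H)" "valid n A" "valid n [a, b]" "valid n [c, d]" "valid n B"
    using sigma_cases[OF assms(1,2,3) n1] .
  note R = H(4)
  note v = H(5-8)
  note pe = R_related_phi_eps[OF R assms(5,4)]
  have vab: "valid n ([a, b] @ B)" "valid n ([c, d] @ B)" using v by auto
  note fa = f_op_append[OF assms(5,4)] and pa = phi_append[OF assms(5,4)]
    and ea = eps_append[OF assms(5,4)] and posa = pos_append[OF assms(5,4)]
  have pe2: "phi n k ([c, d] @ B) = phi n k ([a, b] @ B)" "eps n k ([c, d] @ B) = eps n k ([a, b] @ B)"
    using pa[OF v(2,4)] pa[OF v(3,4)] ea[OF v(2,4)] ea[OF v(3,4)] pe by simp_all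
  show "phi n k (sigma n i H) = phi n k H"
    unfolding H(2) using pa[OF v(1) vab(1)] pa[OF v(1) vab(2)] pe2 H(1) by simp
  have sg: "sigma n i (A' @ [a', b'] @ B') = A' @ [c', d'] @ B'" "W_at n i (A' @ [a', b'] @ B') = w'"
    if "R_related n a' b' c' d' w'" "length B' = length B" for A' a' b' c' d' w' B'
    using sigma_split[of B' i n A' a' b'] that H(3) assms(1) R_related_R_matrix[OF that(1) n1] by simp_all
  have main: "f_op n k (sigma n i H) = map_option (sigma n i) (f_op n k H) \<and>
    (\<forall>H'. f_op n k H = Some H' \<longrightarrow> int (W_at n i H') = int (W_at n i H) +
      (if k = 0 then of_bool (pos n k H = i + 1) - of_bool (pos n k (sigma n i H) = i) else 0))"
  proof (cases "phi n k ([a, b] @ B) > eps n k A")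
    case 1: True
    show ?thesis
    proof (cases "phi n k B > eps n k [a, b]")
      case 2: True
      then obtain B' where B': "f_op n k B = Some B'"
        using f_op_None_iff[of n k B] by (cases "f_op n k B") auto
      have lB: "length B' = length B" using f_op_valid[OF assms(5,4) v(4) B'] by (metis length_map)
      have f: "f_op n k H = Some (A @ [a, b] @ B')"
        unfolding H(1) fa[OF v(1) vab(1)] fa[OF v(2,4)] using 1 2 B' by simp
      have fs: "f_op n k (sigma n i H) = Some (A @ [c, d] @ B')"
        unfolding H(2) fa[OF v(1) vab(2)] fa[OF v(3,4)] using 1 2 B' pe pe2 by simp
      have "pos n k H \<le> length B" "pos n k (sigma n i H) \<le> length B"
        unfolding H(2) unfolding H(1) posa[OF v(1) vab(1)] posa[OF v(1) vab(2)] posa[OF v(2,4)] posa[OF v(3,4)]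
        using 1 2 pe pe2 pos_le[OF assms(5,4), of B] by simp_all
      then show ?thesis
        using f fs sg[OF R lB] H(3) assms(1) by (auto simp del: append.simps)
    next
      case 2: False
      have ph: "phi n k [a, b] > 0" using 1 2 pa[OF v(2,4)] by simp
      then obtain a' b' where ab': "f_op n k [a, b] = Some [a', b']"
        using f_op_pairE[OF assms(5,4) v(2)] by blast
      obtain c' d' w' where cd': "f_op n k [c, d] = Some [c', d']" "R_related n a' b' c' d' w'"
        "int w' = int (W_at n i H) +
          (if k = 0 then of_bool (pos n k [a, b] = 2) - of_bool (pos n k [c, d] = 1) else 0)"
        using R_related_f_op[OF R assms(5,4) ab'] by blast
      have f: "f_op n k H = Some (A @ [a', b'] @ B)"
        unfolding H(1) fa[OF v(1) vab(1)] fa[OF v(2,4)] using 1 2 ab' by simp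
      have fs: "f_op n k (sigma n i H) = Some (A @ [c', d'] @ B)"
        unfolding H(2) fa[OF v(1) vab(2)] fa[OF v(3,4)] using 1 2 cd' pe pe2 by simp
      have "pos n k H = pos n k [a, b] + length B" "pos n k (sigma n i H) = pos n k [c, d] + length B"
        unfolding H(2) unfolding H(1) posa[OF v(1) vab(1)] posa[OF v(1) vab(2)] posa[OF v(2,4)] posa[OF v(3,4)]
        using 1 2 pe pe2 pos_pos_iff[OF assms(5,4) v(2)] pos_pos_iff[OF assms(5,4) v(3)] ph
        by simp_all
      then have "pos n k H = i + 1 \<longleftrightarrow> pos n k [a, b] = 2"
        "pos n k (sigma n i H) = i \<longleftrightarrow> pos n k [c, d] = 1"
        using H(3) assms(1) by linarith+
      then show ?thesis
        unfolding f fs option.map sg[OF cd'(2) refl] using cd'(3) sg(2)[OF cd'(2) refl] by (cases "k = 0") simp_all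
    qed
  next
    case 1: False
    show ?thesis
    proof (cases "f_op n k A")
      case None
      then have "f_op n k H = None" "f_op n k (sigma n i H) = None"
        unfolding H(2) unfolding H(1) fa[OF v(1) vab(1)] fa[OF v(1) vab(2)] using 1 pe2 by simp_all
      then show ?thesis by simp
    next
      case (Some A')
      have f: "f_op n k H = Some (A' @ [a, b] @ B)"
        unfolding H(1) fa[OF v(1) vab(1)] using 1 Some by simp
      have fs: "f_op n k (sigma n i H) = Some (A' @ [c, d] @ B)"
        unfolding H(2) fa[OF v(1) vab(2)] using 1 Some pe2 by simp
      have "pos n k A > 0" using pos_pos_iff[OF assms(5,4) v(1)] Some f_op_None_iff[of n k A] by simp
      then have "pos n k H > i + 1" "pos n k (sigma n i H) > i + 1"
        unfolding H(2) unfolding H(1) posa[OF v(1) vab(1)] posa[OF v(1) vab(2)]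
        using 1 pe2 H(3) assms(1) by simp_all
      then show ?thesis
        using f fs sg[OF R refl] by (auto simp del: append.simps)
    qed
  qed
  then show "f_op n k (sigma n i H) = map_option (sigma n i) (f_op n k H)"
    "f_op n k H = Some H' \<Longrightarrow> int (W_at n i H') = int (W_at n i H) +
      (if k = 0 then of_bool (pos n k H = i + 1) - of_bool (pos n k (sigma n i H) = i) else 0)"
    by blast+
qed

text \<open>Derived from \<open>sigma_f_op\<close>: \<open>e_op\<close> is the partial inverse of
  \<open>f_op\<close>, and sigma_i is bijective on valid tensors with a given number of factors, so
  an arrow into the image of H can be pulled back to an arrow into H.\<close>

lemma sigma_e_op:
  assumes "1 \<le> i" "i < length H" "valid n H" "n \<ge> 2" "k < n"
  shows "e_op n k (sigma n i H) = map_option (sigma n i) (e_op n k H)"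
proof -
  note s = sigma_basic[OF assms(1-3)] and fo = sigma_f_op(1)[OF assms(1) _ _ assms(4,5)]
  have n1: "n \<ge> 1" using assms by simp
  show ?thesis
  proof (cases "e_op n k (sigma n i H)")
    case (Some X)
    have fX: "f_op n k X = Some (sigma n i H)"
      using e_op_inverse[OF assms(5,4) s(1)[OF n1] Some] .
    have X: "valid n X" "length X = length H"
      using e_op_valid[OF assms(5,4) s(1)[OF n1] Some] s(2)[OF n1] by (auto dest: map_eq_imp_length_eq)
    then obtain Y where Y: "valid n Y" "length Y = length H" "sigma n i Y = X"
      using sigma_surj[OF assms(1), of X n] assms(2) n1 by auto
    have "map_option (sigma n i) (f_op n k Y) = Some (sigma n i H)"
      using fo[of Y] Y assms(2) fX by simp
    then obtain Z where Z: "f_op n k Y = Some Z" "sigma n i Z = sigma n i H" by auto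
    have "valid n Z" "length Z = length H"
      using f_op_valid[OF assms(5,4) Y(1) Z(1)] Y(2) by (auto dest: map_eq_imp_length_eq)
    then have "Z = H" using sigma_inject[OF assms(1) _ _ _ assms(3) n1 Z(2)] assms(2) by simp
    then have "e_op n k H = Some Y" using f_op_inverse[OF assms(5,4) Y(1) Z(1)] by simp
    then show ?thesis using Some Y(3) by simp
  next
    case None
    show ?thesis
    proof (cases "e_op n k H")
      case (Some X)
      have X: "valid n X" "length X = length H"
        using e_op_valid[OF assms(5,4,3) Some] by (auto dest: map_eq_imp_length_eq)
      have "f_op n k X = Some H" using e_op_inverse[OF assms(5,4,3) Some] .
      then have "f_op n k (sigma n i X) = Some (sigma n i H)"
        using fo[of X] X assms(2) by simp
      moreover have "valid n (sigma n i X)" using sigma_basic(1)[OF assms(1) _ X(1) n1] X(2) assms(2) by simp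
      ultimately have "e_op n k (sigma n i H) = Some (sigma n i X)"
        using f_op_inverse[OF assms(5,4)] by blast
      then show ?thesis using None by simp
    qed (use None in simp)
  qed
qed

section \<open>Energy\<close>

abbreviation sigmas :: "nat \<Rightarrow> nat list \<Rightarrow> tensor \<Rightarrow> tensor" where
  "sigmas n is H \<equiv> foldr (sigma n) is H"

lemma sigmas_basic:
  assumes "set is \<subseteq> {1..<length H}" "valid n H" "n \<ge> 1"
  shows "valid n (sigmas n is H)" "length (sigmas n is H) = length H"
    "mset (map length (sigmas n is H)) = mset (map length H)"
    "mset (concat (sigmas n is H)) = mset (concat H)"
proof -
  have "valid n (sigmas n is H) \<and> length (sigmas n is H) = length H \<and>
    mset (map length (sigmas n is H)) = mset (map length H) \<and>
    mset (concat (sigmas n is H)) = mset (concat H)"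
    using assms(1)
  proof (induction "is")
    case (Cons i "is")
    then show ?case
      using sigma_basic(1-4)[of i "sigmas n is H" n] assms(2,3) by simp
  qed (use assms in simp)
  then show "valid n (sigmas n is H)" "length (sigmas n is H) = length H"
    "mset (map length (sigmas n is H)) = mset (map length H)"
    "mset (concat (sigmas n is H)) = mset (concat H)" by blast+
qed

lemma sigmas_lengths:
  assumes "set is \<subseteq> {1..<length H}" "valid n H" "valid n H'" "n \<ge> 1" "map length H' = map length H"
  shows "map length (sigmas n is H') = map length (sigmas n is H)"
  using assms(1)
proof (induction "is")
  case (Cons i "is")
  have l: "length H' = length H" using assms(5) by (rule map_eq_imp_length_eq)
  have "set is \<subseteq> {1..<length H}" "set is \<subseteq> {1..<length H'}" using Cons.prems l by simp_all
  note b = sigmas_basic(1,2)[OF this(1) assms(2,4)] and b' = sigmas_basic(1,2)[OF this(2) assms(3,4)]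
  have IH: "map length (sigmas n is H') = map length (sigmas n is H)" using Cons by simp
  have i: "1 \<le> i" "i < length H" using Cons.prems by simp_all
  show ?case
    using sigma_basic(5)[OF i(1) _ b(1) assms(4)] sigma_basic(5)[OF i(1) _ b'(1) assms(4)]
      b(2) b'(2) l i IH by simp
qed (use assms in simp)

lemma sigmas_inject:
  assumes "set is \<subseteq> {1..<length H}" "length H' = length H" "valid n H" "valid n H'" "n \<ge> 1"
    "sigmas n is H = sigmas n is H'"
  shows "H = H'"
  using assms(1,6)
proof (induction "is")
  case (Cons i "is")
  have s: "set is \<subseteq> {1..<length H}" "set is \<subseteq> {1..<length H'}" using Cons.prems(1) assms(2) by simp_all
  note b = sigmas_basic(1,2)[OF s(1) assms(3,5)] and b' = sigmas_basic(1,2)[OF s(2) assms(4,5)]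
  have i: "1 \<le> i" "i < length (sigmas n is H)" using Cons.prems(1) b(2) by simp_all
  have "length (sigmas n is H) = length (sigmas n is H')" using b(2) b'(2) assms(2) by metis
  moreover have "sigma n i (sigmas n is H) = sigma n i (sigmas n is H')"
    using Cons.prems(2) by (simp only: foldr.simps comp_apply)
  ultimately have "sigmas n is H = sigmas n is H'"
    using sigma_inject[OF i _ b(1) b'(1) assms(5)] by blast
  with s(1) show ?case by (rule Cons.IH)
qed simp

lemma sigmas_ops:
  assumes "set is \<subseteq> {1..<length H}" "valid n H" "n \<ge> 2" "k < n"
  shows "f_op n k (sigmas n is H) = map_option (sigmas n is) (f_op n k H)"
    "e_op n k (sigmas n is H) = map_option (sigmas n is) (e_op n k H)"
proof -
  have n1: "n \<ge> 1" using assms by simp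
  have "f_op n k (sigmas n is H) = map_option (sigmas n is) (f_op n k H) \<and>
    e_op n k (sigmas n is H) = map_option (sigmas n is) (e_op n k H)"
    using assms(1)
  proof (induction "is")
    case Nil
    then show ?case by (simp add: option.map_ident)
  next
    case (Cons i "is")
    then have "set is \<subseteq> {1..<length H}" by simp
    note b = sigmas_basic(1,2)[OF this assms(2) n1]
    show ?case
      using Cons sigma_f_op(1)[of i "sigmas n is H" n k] sigma_e_op[of i "sigmas n is H" n k] b assms(3,4)
      by (simp add: option.map_comp comp_def)
  qed
  then show "f_op n k (sigmas n is H) = map_option (sigmas n is) (f_op n k H)"
    "e_op n k (sigmas n is H) = map_option (sigmas n is) (e_op n k H)" by blast+
qed

lemma pos_1_last:
  assumes "valid n H" "n \<ge> 2" "k < n" "pos n k H = 1"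
  shows "close_letter n k \<in> set (last H)"
  using assms(1,4)
proof (induction H)
  case (Cons h H)
  then show ?case
    using pos_le[OF assms(3,2), of H] by (cases "H = []") (auto simp: pos.simps cnt_pos_iff split: if_splits)
qed (simp add: pos.simps)

text \<open>
  The change of \<open>W\<^sub>i\<close> under \<open>f\<^sub>0\<close> is \<open>[p = i + 1] - [p' = i]\<close>, where \<open>p\<close> and \<open>p'\<close> are the
  positions at which \<open>f\<^sub>0\<close> acts before and after \<open>\<sigma>\<^sub>i\<close>. Hence the sum over \<open>i < j\<close> telescopes.
\<close>

lemma energy_f_op:
  assumes "valid n G" "n \<ge> 2" "k < n" "f_op n k G = Some G'"
    and last: "k = 0 \<Longrightarrow> \<forall>j\<in>{1..length G}. n \<notin> set (last (sigmas n [1..<j] G))"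
  shows "energy n G' = energy n G + (if k = 0 then 1 else 0)"
proof -
  have n1: "n \<ge> 1" using assms by simp
  have l: "length G' = length G"
    using f_op_valid[OF assms(3,2,1,4)] by (auto dest: map_eq_imp_length_eq)
  \<comment> \<open>Before sigma_i is applied, position i + 1 is what \<open>q j (Suc i)\<close>
    records; afterwards, position i is what \<open>q j i\<close> records. Thus both terms in the
    change of W_i come from one sequence. The factor \<open>\<delta>\<close> treats k = 0 and the
    classical k, for which W_i is constant, at once.\<close>
  define q :: "nat \<Rightarrow> nat \<Rightarrow> int" where "q j i = of_bool (pos n k (sigmas n [i..<j] G) = i)" for i j
  define \<delta> :: int where "\<delta> = (if k = 0 then 1 else 0)"
  have step: "int (W_at n i (sigmas n [i + 1..<j] G')) - int (W_at n i (sigmas n [i + 1..<j] G))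
      = \<delta> * (q j (Suc i) - q j i)" if "1 \<le> i" "i < j" "j \<le> length G" for i j
  proof -
    have s: "set [i + 1..<j] \<subseteq> {1..<length G}" using that by auto
    note b = sigmas_basic(1,2)[OF s assms(1) n1]
    have f: "f_op n k (sigmas n [i + 1..<j] G) = Some (sigmas n [i + 1..<j] G')"
      using sigmas_ops(1)[OF s assms(1,2,3)] assms(4) by simp
    have "sigma n i (sigmas n [i + 1..<j] G) = sigmas n [i..<j] G"
      using that by (simp add: upt_conv_Cons)
    then show ?thesis
      using sigma_f_op(3)[OF that(1) _ b(1) assms(2,3) f] b(2) that
      by (simp add: q_def \<delta>_def)
  qed
  have "int (energy n G') - int (energy n G) =
      (\<Sum>j = 1..length G. \<Sum>i = 1..<j. \<delta> * (q j (Suc i) - q j i))"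
    unfolding energy_def l of_nat_sum sum_subtractf[symmetric]
    by (intro sum.cong refl) (rule step, auto)
  also have "\<dots> = (\<Sum>j = 1..length G. \<delta> * (q j j - q j 1))"
    by (intro sum.cong refl) (simp add: sum_distrib_left[symmetric] sum_Suc_diff')
  \<comment> \<open>At the upper end no sigma is applied, so \<open>q j j\<close> asks whether
    \<open>f_op\<close> acts on factor j of G itself; this holds for exactly one j. At the lower end
    \<open>last\<close> keeps f_0 away from the rightmost factor.\<close>
  also have "\<dots> = (\<Sum>j = 1..length G. \<delta> * of_bool (j = pos n k G))"
  proof (intro sum.cong refl)
    fix j assume j: "j \<in> {1..length G}"
    have "q j 1 = 0" if "k = 0"
    proof -
      have s: "set [1..<j] \<subseteq> {1..<length G}" using j by auto
      have "close_letter n k = n" using that by (simp add: close_letter_def)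
      then show ?thesis
        using pos_1_last[OF sigmas_basic(1)[OF s assms(1) n1] assms(2,3)] last[OF that] j
        by (auto simp: q_def)
    qed
    then show "\<delta> * (q j j - q j 1) = \<delta> * of_bool (j = pos n k G)"
      by (auto simp: \<delta>_def q_def)
  qed
  also have "\<dots> = \<delta>"
  proof -
    have "phi n k G > 0" using f_op_None_iff[of n k G] assms(4) by simp
    then have "pos n k G \<in> {1..length G}"
      using pos_pos_iff[OF assms(3,2,1)] pos_le[OF assms(3,2), of G] by auto
    then show ?thesis
      by (simp add: sum_distrib_left[symmetric] of_bool_def sum.delta)
  qed
  finally show ?thesis by (simp add: \<delta>_def split: if_splits)
qed

section \<open>Highest weight tensors\<close>

lemma eps_0_last:
  assumes "valid n H" "n \<ge> 2" "k < n" "eps n k H = 0" "H \<noteq> []"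
  shows "open_letter k \<notin> set (last H)"
  using assms(1,4,5)
proof (induction H)
  case (Cons h H)
  then show ?case
    using cnt_pos_iff[of h "open_letter k"] assms(2,3) by (cases "H = []") (auto simp: eps_Cons)
qed simp

definition highest :: "nat \<Rightarrow> tensor \<Rightarrow> bool" where
  "highest n H \<longleftrightarrow> (\<forall>i\<in>{1..<n}. e_op n i H = None)"

lemma highest_sigmas:
  assumes "set is \<subseteq> {1..<length H}" "valid n H" "n \<ge> 2" "highest n H"
  shows "highest n (sigmas n is H)"
  using assms sigmas_ops(2)[OF assms(1-3)] by (simp add: highest_def)

text \<open>Nothing stands to the right of the last factor, so its Opens are never cancelled: a
  letter x > 1 there would make e_op at index x - 1 nonzero.\<close>

lemma highest_last:
  assumes "valid n H" "n \<ge> 2" "highest n H" "H \<noteq> []"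
  shows "set (last H) \<subseteq> {1}"
proof
  fix x assume x: "x \<in> set (last H)"
  have "last H \<in> set H" using assms(4) by simp
  then have "x \<in> {1..n}" using x assms(1) unfolding valid_def by blast
  show "x \<in> {1}"
  proof (rule ccontr)
    assume "x \<notin> {1}"
    then have k: "x - 1 \<in> {1..<n}" "open_letter (x - 1) = x" 
      using \<open>x \<in> {1..n}\<close> by (auto simp: open_letter_def)
    then have "eps n (x - 1) H = 0" using assms(3) e_op_None_iff unfolding highest_def by blast
    then show False using eps_0_last[of n H "x - 1"] assms k x by auto
  qed
qed

lemma phi_pos_letter:
  assumes "valid n H" "n \<ge> 2" "k < n" "phi n k H > 0"
  shows "close_letter n k \<in> set (concat H)"
  using assms(1,4)
proof (induction H)
  case (Cons h H)
  then show ?case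
    using cnt_pos_iff[of h "close_letter n k"] assms(2,3) by (auto simp: phi_Cons)
qed simp

abbreviation support_size :: "tensor \<Rightarrow> nat" where
  "support_size H \<equiv> length (filter (\<lambda>h. h \<noteq> []) H)"

text \<open>Factors are added on the left. As no classical Open may survive, a letter x > 1 in the
  new factor must be cancelled by a letter x - 1 further right. Hence each nonempty factor raises
  the largest letter by at most 1.\<close>

lemma highest_letter_le:
  assumes "valid n H" "n \<ge> 2" "highest n H" "x \<in> set (concat H)"
  shows "x \<le> support_size H"
  using assms(1,3,4)
proof (induction H arbitrary: x)
  case (Cons h H)
  have eps: "eps n i H = 0 \<and> cnt h (open_letter i) \<le> phi n i H" if "i \<in> {1..<n}" for i
    using that Cons.prems(1,2) assms(2) by (auto simp: highest_def e_op_None_iff eps_Cons)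
  then have IH: "y \<le> support_size H" if "y \<in> set (concat H)" for y
    using Cons that by (auto simp: highest_def e_op_None_iff)
  show ?case
  proof (cases "x \<in> set h")
    case True
    then have h: "h \<noteq> []" by auto
    show ?thesis
    proof (cases "x \<le> 1")
      case False
      then have i: "x - 1 \<in> {1..<n}" "open_letter (x - 1) = x" "close_letter n (x - 1) = x - 1"
        using True Cons.prems(1) by (auto simp: open_letter_def close_letter_def)
      have "cnt h x > 0" using True by (simp add: cnt_pos_iff)
      then have "phi n (x - 1) H > 0" using eps[OF i(1)] unfolding i(2) by linarith
      then have "x - 1 \<in> set (concat H)"
        using phi_pos_letter[of n H "x - 1"] Cons.prems(1) assms(2) i by simp
      then show ?thesis using IH[of "x - 1"] h by simp
    qed (use h in simp)
  next
    case False
    then show ?thesis using IH[of x] Cons.prems(3) by simp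
  qed
qed simp

text \<open>A Close is cancelled only by an Open to its left. By \<open>highest_letter_le\<close>
  the letters n lie in the leftmost nonempty factor, and read backwards this factor begins with
  them. The bound on the number of factors is essential: for n = 2 the highest weight tensor with
  one-letter factors 1, 2, 1 has its 2 cancelled by the 1 to its left.\<close>

lemma highest_phi_0:
  assumes "valid n H" "n \<ge> 2" "highest n H" "n \<in> set (concat H)" "support_size H \<le> n"
  shows "phi n 0 H > 0"
  using assms(1,3,4,5)
proof (induction H)
  case (Cons h H)
  have "highest n H"
    using Cons.prems(1,2) assms(2) by (auto simp: highest_def e_op_None_iff eps_Cons)
  show ?case
  proof (cases "h = []")
    case True
    then show ?thesis using Cons \<open>highest n H\<close> assms(2) by (simp add: phi_Cons cnt_def)
  next
    case False
    then have "support_size H < n" using Cons.prems(4) by simp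
    then have "n \<notin> set (concat H)"
      using highest_letter_le[of n H n] \<open>highest n H\<close> Cons.prems(1) assms(2) by fastforce
    then have "cnt h n > 0" using Cons.prems(3) by (simp add: cnt_pos_iff)
    then show ?thesis using Cons.prems(1) assms(2) by (simp add: phi_Cons close_letter_def)
  qed
qed simp

lemma phi_0_pos:
  assumes "valid n H" "n \<ge> 2" "n \<in> set (concat H)" "1 \<notin> set (concat H)"
  shows "phi n 0 H > 0"
  using assms(1,3,4)
proof (induction H)
  case (Cons h H)
  have "cnt h (open_letter 0) = 0" using Cons.prems(3) cnt_pos_iff[of h 1] by (simp add: open_letter_def)
  then have phi: "phi n 0 (h # H) = cnt h n + phi n 0 H"
    using Cons.prems(1) assms(2) by (simp add: phi_Cons close_letter_def)
  show ?case
  proof (cases "n \<in> set h")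
    case True
    then show ?thesis using phi cnt_pos_iff[of h n] by simp
  next
    case False
    then have "phi n 0 H > 0" using Cons.prems by (intro Cons.IH) simp_all
    then show ?thesis using phi by simp
  qed
qed simp

section \<open>Shifting all letters\<close>

lemma winds_Suc: "winds (Suc x) (map Suc b) \<longleftrightarrow> winds x b"
  by (auto simp: winds_def)

lemma partner_Suc:
  assumes "b \<noteq> []" shows "partner (Suc x) (map Suc b) = Suc (partner x b)"
proof (cases "winds x b")
  case True
  then show ?thesis
    using assms by (simp add: partner_def winds_Suc mono_Max_commute[symmetric] mono_def)
next
  case False
  then have "{y \<in> set b. y < x} \<noteq> {}" by (auto simp: winds_def)
  moreover have "{y \<in> Suc ` set b. y < Suc x} = Suc ` {y \<in> set b. y < x}" by auto
  ultimately show ?thesis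
    using False by (simp add: partner_def winds_Suc mono_Max_commute[symmetric] mono_def)
qed

lemma remove1_map_Suc: "remove1 (Suc x) (map Suc b) = map Suc (remove1 x b)"
  by (induction b) auto

text \<open>\<open>winds\<close> and \<open>partner\<close> only compare letters, and
  \<open>Suc\<close> preserves all comparisons. Hence winding pairs stay winding pairs, and R
  commutes with the shift as long as no letter leaves the range.\<close>

lemma pairing_Suc:
  "length a \<le> length b \<Longrightarrow> paired (map Suc a) (map Suc b) = map Suc (paired a b) \<and>
     unpaired (map Suc a) (map Suc b) = map Suc (unpaired a b)"
proof (induction a b rule: paired.induct)
  case (2 x a b)
  then have "b \<noteq> []" by auto
  moreover have "length a \<le> length (remove1 (partner x b) b)"
    using 2 partner_in[OF \<open>b \<noteq> []\<close>, of x] by (simp add: length_remove1)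
  ultimately show ?case using 2 by (simp add: partner_Suc remove1_map_Suc)
qed simp

lemma sort_map_Suc: "sort (map Suc h) = map Suc (sort h)"
  by (rule properties_for_sort) (simp_all add: sorted_map sorted_wrt_mono_rel[OF _ sorted_sort])

lemma R_short_Suc:
  assumes "length a \<le> length b" "R_short (a, b) = (c, d)"
  shows "R_short (map Suc a, map Suc b) = (map Suc c, map Suc d)"
  using assms pairing_Suc[OF assms(1)]
  by (auto simp: R_short_def sort_map_Suc simp flip: map_append)

definition shift :: "tensor \<Rightarrow> tensor" where
  "shift = map (map Suc)"

lemma valid_shift: "valid n H \<Longrightarrow> n \<notin> set (concat H) \<Longrightarrow> valid n (shift H)"
  by (auto simp: valid_def shift_def sorted_map elim!: sorted_wrt_mono_rel[rotated])
    (metis Suc_leI atLeastAtMost_iff le_neq_implies_less subsetD)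

lemma exchanged_shift:
  assumes "exchanged n a b c d w" "length a \<le> length b" "n \<notin> set a" "n \<notin> set b" "n \<ge> 1"
  shows "\<exists>w. exchanged n (map Suc a) (map Suc b) (map Suc c) (map Suc d) w"
proof -
  have v: "valid n [a, b]" using assms(1) unfolding exchanged_def by blast
  obtain c' d' where cd: "R_short (a, b) = (c', d')" "exchanged n a b c' d' (winding_number a b)"
    using exchanged_R_short[OF v assms(2,5)] by blast
  then have "R_short (a, b) = (c, d)" using exchanged_unique[OF assms(1) cd(2) assms(5)] by simp
  note R = R_short_Suc[OF assms(2) this]
  have "valid n [map Suc a, map Suc b]"
    using valid_shift[of n "[a, b]"] v assms(3,4) by (simp add: shift_def)
  from exchanged_R_short[OF this _ assms(5)] R show ?thesis using assms(2) by auto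
qed

lemma R_related_shift:
  assumes "R_related n a b c d w" "n \<notin> set a" "n \<notin> set b" "n \<ge> 1"
  shows "\<exists>w. R_related n (map Suc a) (map Suc b) (map Suc c) (map Suc d) w"
proof (cases "length a \<le> length b")
  case True
  then show ?thesis using exchanged_shift[of n a b c d w] assms unfolding R_related_def by simp
next
  case False
  have m: "mset c + mset d = mset a + mset b" and l: "length c = length b" "length d = length a"
    using R_related_basic[OF assms(1)] by auto
  have "set c \<union> set d = set a \<union> set b" using arg_cong[OF m, of set_mset] by simp
  then show ?thesis using exchanged_shift[of n c d a b w] assms False l unfolding R_related_def by auto
qed

lemma sigma_shift:
  assumes "1 \<le> i" "i < length H" "valid n H" "n \<ge> 1" "n \<notin> set (concat H)"
  shows "sigma n i (shift H) = shift (sigma n i H)"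
proof -
  obtain A a b c d B where H: "H = A @ [a, b] @ B" "sigma n i H = A @ [c, d] @ B"
    "length B = i - 1" "R_related n a b c d (W_at n i H)"
    using sigma_cases[OF assms(1-4)] by metis
  have "n \<notin> set a" "n \<notin> set b" using assms(5) H(1) by simp_all
  from R_related_shift[OF H(4) this assms(4)] R_related_R_matrix(1)[OF _ assms(4)]
  have "R_matrix n (map Suc a, map Suc b) = (map Suc c, map Suc d)" by blast
  then show ?thesis
    unfolding H(2) unfolding H(1)
    using sigma_split(1)[of "map (map Suc) B" i n "map (map Suc) A" "map Suc a" "map Suc b"] H(3) assms(1)
    by (simp add: shift_def)
qed

section \<open>Raising letters by classical operators\<close>

definition classical_step :: "nat \<Rightarrow> tensor \<Rightarrow> tensor \<Rightarrow> bool" where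
  "classical_step n H H' \<longleftrightarrow> (\<exists>i\<in>{1..<n}. f_op n i H = Some H')"

abbreviation raise_letter :: "nat \<Rightarrow> nat \<Rightarrow> nat" where
  "raise_letter i \<equiv> (\<lambda>x. if x = i then Suc i else x)"

text \<open>\<open>raise_letter i\<close> identifies i with i + 1, so the image of a tensor under it
  is an invariant of f_i. It names the far end of the i-string before any step is taken.\<close>

lemma f_op_raise:
  assumes "valid n H" "i \<in> {1..<n}" "n \<ge> 2" "f_op n i H = Some H'"
  shows "map (\<lambda>h. sort (map (raise_letter i) h)) H' = map (\<lambda>h. sort (map (raise_letter i) h)) H \<and>
    cnt (concat H) i = Suc (cnt (concat H') i)"
  using assms(1,4)
proof (induction H arbitrary: H')
  case (Cons h H)
  have i: "i < n" "close_letter n i = i" "open_letter i = Suc i"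
    using assms(2) by (auto simp: open_letter_def close_letter_def)
  show ?case
  proof (cases "phi n i H > cnt h (Suc i)")
    case True
    then obtain H1 where "f_op n i H = Some H1" "H' = h # H1"
      using Cons.prems i assms(3) by (auto simp: f_op_Cons)
    then show ?thesis using Cons by (simp add: cnt_def)
  next
    case False
    then have c: "cnt h i > 0" and H': "H' = upd i (Suc i) h # H"
      using Cons.prems i assms(3) by (auto simp: f_op_Cons split: if_splits)
    have "i \<in># mset h" using c cnt_pos_iff[of h i] by simp
    then obtain M where M: "mset h = add_mset i M" by (metis multi_member_split)
    have "sort (map (raise_letter i) (upd i (Suc i) h)) = sort (map (raise_letter i) h)"
      by (rule properties_for_sort) (simp_all only: sorted_sort mset_sort mset_map mset_upd M, simp)
    then show ?thesis unfolding H' using M by (simp add: cnt_def mset_upd)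
  qed
qed simp

text \<open>The assumption says that no letter i is cancelled. One application of f_i lowers both
  sides by 1, so the assumption persists until no i is left; there the sorted invariant is the
  tensor itself.\<close>

lemma classical_path_raise_aux:
  assumes "valid n H" "i \<in> {1..<n}" "n \<ge> 2" "phi n i H = cnt (concat H) i"
  shows "(classical_step n)\<^sup>*\<^sup>* H (map (\<lambda>h. sort (map (raise_letter i) h)) H)"
  using assms(1,4)
proof (induction "phi n i H" arbitrary: H)
  case 0
  then have "i \<notin> set (concat H)" using cnt_pos_iff[of "concat H" i] by simp
  have "sort (map (raise_letter i) h) = h" if "h \<in> set H" for h
  proof -
    have "map (raise_letter i) h = h"
      using that \<open>i \<notin> set (concat H)\<close> by (intro map_idI) auto
    then show ?thesis using that 0(2) by (simp add: valid_def sorted_sort_id)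
  qed
  then have "map (\<lambda>h. sort (map (raise_letter i) h)) H = H" by (intro map_idI)
  then show ?case by simp
next
  case (Suc k)
  have i: "i < n" using assms(2) by simp
  obtain H' where H': "f_op n i H = Some H'"
    using Suc(2) f_op_None_iff[of n i H] by (cases "f_op n i H") auto
  note r = f_op_raise[OF Suc(3) assms(2,3) H']
  have "k = phi n i H'" "valid n H'" "phi n i H' = cnt (concat H') i"
    using Suc r f_op_inverse[OF i assms(3) Suc(3) H'] f_op_valid[OF i assms(3) Suc(3) H'] by simp_all
  from Suc(1)[OF this] have "(classical_step n)\<^sup>*\<^sup>* H' (map (\<lambda>h. sort (map (raise_letter i) h)) H)"
    using r by simp
  moreover have "classical_step n H H'" using H' assms(2) by (auto simp: classical_step_def)
  ultimately show ?case by (meson converse_rtranclp_into_rtranclp)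
qed

lemma classical_path_raise:
  assumes "valid n H" "i \<in> {1..<n}" "n \<ge> 2" "Suc i \<notin> set (concat H)"
  shows "(classical_step n)\<^sup>*\<^sup>* H (map (map (raise_letter i)) H)"
proof -
  have i: "i < n" "close_letter n i = i" "open_letter i = Suc i"
    using assms(2) by (auto simp: open_letter_def close_letter_def)
  have "phi n i H = cnt (concat H) i"
    using assms(1,4)
  proof (induction H)
    case (Cons h H)
    have "cnt h (Suc i) = 0" using Cons.prems(2) cnt_pos_iff[of h "Suc i"] by simp
    then show ?case using Cons i assms(3) by (simp add: phi_Cons) (simp add: cnt_def)
  qed (simp add: cnt_def)
  note p = classical_path_raise_aux[OF assms(1-3) this]
  have "sort (map (raise_letter i) h) = map (raise_letter i) h" if "h \<in> set H" for h
  proof (rule sorted_sort_id)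
    have "sorted h" "Suc i \<notin> set h" using that assms(1,4) by (auto simp: valid_def)
    then show "sorted (map (raise_letter i) h)"
      unfolding sorted_map by (elim sorted_wrt_mono_rel[rotated]) (auto simp: le_Suc_eq)
  qed
  then have "map (\<lambda>h. sort (map (raise_letter i) h)) H = map (map (raise_letter i)) H" by simp
  with p show ?thesis by (simp only:)
qed

lemma classical_path_shift:
  assumes "valid n H" "n \<ge> 2" "n \<notin> set (concat H)"
  shows "(classical_step n)\<^sup>*\<^sup>* H (shift H)"
proof -
  \<comment> \<open>Letters are raised from the top down, with all letters from \<open>k\<close> on
    already raised in \<open>S k\<close>. Then k + 1 is absent from \<open>S (Suc k)\<close>, so f_k
    meets no Open and leads to \<open>S k\<close>. The two ends are \<open>S n = H\<close>, as n
    does not occur, and \<open>S 1 = shift H\<close>.\<close>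
  define S where "S k = map (map (\<lambda>x. if k \<le> x then Suc x else x)) H" for k
  have range: "x \<in> {1..<n}" if "h \<in> set H" "x \<in> set h" for h x
  proof -
    have "x \<in> {1..n}" using that assms(1) unfolding valid_def by blast
    moreover have "x \<noteq> n" using that assms(3) by auto
    ultimately show ?thesis by simp
  qed
  have "(classical_step n)\<^sup>*\<^sup>* H (S k)" if "1 \<le> k" "k \<le> n" for k
    using that(2,1)
  proof (induction k rule: inc_induct)
    case base
    have "S n = H" unfolding S_def using range by (intro map_idI) fastforce
    then show ?case by simp
  next
    case (step k)
    have "valid n (S (Suc k))"
      unfolding valid_def
    proof
      fix h assume "h \<in> set (S (Suc k))"
      then obtain h0 where h0: "h0 \<in> set H" "h = map (\<lambda>x. if Suc k \<le> x then Suc x else x) h0"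
        by (auto simp: S_def)
      have "sorted h0" using h0(1) assms(1) by (auto simp: valid_def)
      then have "sorted h"
        unfolding h0(2) sorted_map by (elim sorted_wrt_mono_rel[rotated]) auto
      moreover have "set h \<subseteq> {1..n}" using range[OF h0(1)] unfolding h0(2) by force
      ultimately show "sorted h \<and> set h \<subseteq> {1..n}" ..
    qed
    moreover have "Suc k \<notin> set (concat (S (Suc k)))" by (auto simp: S_def)
    moreover have "map (map (raise_letter k)) (S (Suc k)) = S k" by (auto simp: S_def)
    ultimately have "(classical_step n)\<^sup>*\<^sup>* (S (Suc k)) (S k)"
      using classical_path_raise[of n "S (Suc k)" k] assms(2) step by simp
    then show ?case using step by (meson le_SucI rtranclp_trans)
  qed
  then have "(classical_step n)\<^sup>*\<^sup>* H (S 1)" using assms(2) by simp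
  moreover have "S 1 = shift H"
    unfolding S_def shift_def using range by (intro map_cong refl) force
  ultimately show ?thesis by simp
qed

lemma sigmas_shift:
  assumes "set is \<subseteq> {1..<length H}" "valid n H" "n \<ge> 1" "n \<notin> set (concat H)"
  shows "sigmas n is (shift H) = shift (sigmas n is H)"
  using assms(1)
proof (induction "is")
  case (Cons i "is")
  then have s: "set is \<subseteq> {1..<length H}" by simp
  note b = sigmas_basic[OF s assms(2,3)]
  have "set (concat (sigmas n is H)) = set (concat H)" using b(4) by (rule mset_eq_setD)
  then have "sigma n i (shift (sigmas n is H)) = shift (sigma n i (sigmas n is H))"
    using Cons.prems b(2) assms(4) by (intro sigma_shift[OF _ _ b(1) assms(3)]) auto
  then show ?case using Cons.IH[OF s] by simp
qed simp

lemma classical_path_energy: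
  assumes "(classical_step n)\<^sup>*\<^sup>* H H'" "valid n H" "n \<ge> 2"
  shows "valid n H' \<and> energy n H' = energy n H"
  using assms(1)
proof (induction rule: rtranclp_induct)
  case (step Y Z)
  then obtain i where i: "i \<in> {1..<n}" "f_op n i Y = Some Z" by (auto simp: classical_step_def)
  then show ?case
    using f_op_valid[of i n Y Z] energy_f_op[of n Y i Z] step.IH assms(3) by simp
qed (use assms(2) in simp)

lemma letters_shift_power: "set (concat ((shift ^^ m) H)) = (\<lambda>x. x + m) ` set (concat H)"
proof (induction m)
  case (Suc m)
  have "set (concat (shift X)) = Suc ` set (concat X)" for X by (auto simp: shift_def)
  then show ?case using Suc by (auto simp: image_iff)
qed simp

lemma last_shift_power:
  "H \<noteq> [] \<Longrightarrow> (shift ^^ m) H \<noteq> [] \<and> set (last ((shift ^^ m) H)) = (\<lambda>x. x + m) ` set (last H)"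
proof (induction m)
  case (Suc m)
  then show ?case by (auto simp: shift_def last_map image_iff)
qed simp

lemma raise_energy:
  assumes "valid n G" "n \<ge> 2" "highest n G" "\<not> set (concat G) \<subseteq> {1}" "support_size G \<le> n"
  shows "\<exists>G1 G2. (classical_step n)\<^sup>*\<^sup>* G G1 \<and> f_op n 0 G1 = Some G2 \<and>
    energy n G2 = energy n G + 1"
proof -
  have n1: "n \<ge> 1" using assms(2) by simp
  define r where "r = Max (set (concat G))"
  have L: "set (concat G) \<subseteq> {1..n}" using assms(1) unfolding valid_def by auto
  note set_concat [simp del]
  obtain x where x: "x \<in> set (concat G)" "x \<noteq> 1" using assms(4) by blast
  have rin: "r \<in> set (concat G)" unfolding r_def using x(1) by (intro Max_in List.finite_set) (rule notI, simp)
  have rmax: "y \<le> r" if "y \<in> set (concat G)" for y unfolding r_def using that by simp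
  have r: "2 \<le> r" "r \<le> n" using rmax[OF x(1)] x L rin by (auto simp: subset_iff)
  let ?G = "\<lambda>m. (shift ^^ m) G"
  have P: "valid n (?G m) \<and> length (?G m) = length G \<and> (classical_step n)\<^sup>*\<^sup>* G (?G m) \<and>
      (\<forall>is. set is \<subseteq> {1..<length G} \<longrightarrow> sigmas n is (?G m) = (shift ^^ m) (sigmas n is G))"
    if "m \<le> n - r" for m
    using that
  proof (induction m)
    case (Suc m)
    then have IH: "valid n (?G m)" "length (?G m) = length G" "(classical_step n)\<^sup>*\<^sup>* G (?G m)"
      "\<And>is. set is \<subseteq> {1..<length G} \<Longrightarrow> sigmas n is (?G m) = (shift ^^ m) (sigmas n is G)"
      by auto
    have nin: "n \<notin> set (concat (?G m))"
    proof
      assume "n \<in> set (concat (?G m))"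
      then obtain y where "y \<in> set (concat G)" "n = y + m" unfolding letters_shift_power by blast
      then show False using rmax[of y] Suc.prems by simp
    qed
    have "valid n (?G (Suc m))" using valid_shift[OF IH(1) nin] by simp
    moreover have "length (?G (Suc m)) = length G" using IH(2) by (simp add: shift_def)
    moreover have "(classical_step n)\<^sup>*\<^sup>* G (?G (Suc m))"
      using classical_path_shift[OF IH(1) assms(2) nin] IH(3) by simp
    moreover have "sigmas n is (?G (Suc m)) = (shift ^^ Suc m) (sigmas n is G)"
      if "set is \<subseteq> {1..<length G}" for "is"
      using sigmas_shift[OF _ IH(1) n1 nin, of "is"] IH(2) IH(4)[OF that] that by simp
    ultimately show ?case by blast
  qed (use assms(1) in simp)
  let ?m = "n - r"
  note Pm = P[OF order_refl]
  have lettersn: "n \<in> set (concat (?G ?m))"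
    using rin r unfolding letters_shift_power by (auto intro!: image_eqI[of _ _ r])
  have "phi n 0 (?G ?m) > 0"
  proof (cases "?m = 0")
    case True
    then show ?thesis using highest_phi_0[OF assms(1-3) _ assms(5)] rin r by simp
  next
    case False
    have "1 \<notin> set (concat (?G ?m))"
    proof
      assume "1 \<in> set (concat (?G ?m))"
      then obtain y where y: "y \<in> set (concat G)" "1 = y + ?m" unfolding letters_shift_power by blast
      then have "1 \<le> y" using L by auto
      then show False using y(2) False by linarith
    qed
    then show ?thesis using phi_0_pos[of n "?G ?m"] Pm assms(2) lettersn by blast
  qed
  then obtain G2 where G2: "f_op n 0 (?G ?m) = Some G2"
    using f_op_None_iff[of n 0 "?G ?m"] by (cases "f_op n 0 (?G ?m)") auto
  \<comment> \<open>For G itself this factor contains only the letter 1. Since the sigmas commute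
    with the shift, it now contains only 1 + n - r, which is less than n because r \<ge> 2.\<close>
  have last: "n \<notin> set (last (sigmas n [1..<j] (?G ?m)))" if "j \<in> {1..length (?G ?m)}" for j
  proof -
    have s: "set [1..<j] \<subseteq> {1..<length G}" using that Pm by auto
    note b = sigmas_basic[OF s assms(1) n1]
    have "highest n (sigmas n [1..<j] G)" by (rule highest_sigmas[OF s assms(1-3)])
    moreover have ne: "sigmas n [1..<j] G \<noteq> []" using b(2) that Pm by auto
    ultimately have "set (last (sigmas n [1..<j] G)) \<subseteq> {1}"
      by (intro highest_last[OF b(1) assms(2)])
    moreover have "sigmas n [1..<j] (?G ?m) = (shift ^^ ?m) (sigmas n [1..<j] G)"
      using Pm s by blast
    ultimately show ?thesis using last_shift_power[OF ne, of ?m] r by auto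
  qed
  have "energy n G2 = energy n (?G ?m) + 1"
    using energy_f_op[of n "?G ?m" 0 G2] Pm assms(2) G2 last by auto
  moreover have "energy n (?G ?m) = energy n G"
    using classical_path_energy[of n G "?G ?m"] Pm assms(1,2) by blast
  ultimately show ?thesis using G2 Pm by auto
qed

section \<open>The involution and the dual energy\<close>

definition complement :: "nat \<Rightarrow> nat list \<Rightarrow> nat list" where
  "complement n h = sort (map (\<lambda>j. n + 1 - j) h)"

definition rev_complement :: "nat \<Rightarrow> tensor \<Rightarrow> tensor" where
  "rev_complement n H = rev (map (complement n) H)"

text \<open>Complementation sends the bracket letters i and i + 1 to n + 1 - i and n - i, which
  belong to index n - i with their roles exchanged; it swaps 1 and n, so index 0 is its own
  dual.\<close>

definition dual_index :: "nat \<Rightarrow> nat \<Rightarrow> nat" where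
  "dual_index n i = (if i = 0 then 0 else n - i)"

lemma dual_index:
  assumes "i < n"
  shows "dual_index n i < n" "dual_index n (dual_index n i) = i" "dual_index n i = 0 \<longleftrightarrow> i = 0"
    "n + 1 - close_letter n i = open_letter (dual_index n i)"
    "n + 1 - open_letter i = close_letter n (dual_index n i)"
  using assms by (auto simp: dual_index_def close_letter_def open_letter_def)

lemma complement_complement:
  assumes "sorted h" "set h \<subseteq> {1..n}" shows "complement n (complement n h) = h"
  unfolding complement_def[of n "complement n h"]
proof (rule properties_for_sort)
  have "image_mset (\<lambda>j. n + 1 - (n + 1 - j)) (mset h) = image_mset (\<lambda>j. j) (mset h)"
    using assms(2) by (intro image_mset_cong) (auto simp: subset_iff)
  then show "mset h = mset (map (\<lambda>j. n + 1 - j) (complement n h))"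
    by (simp add: complement_def image_mset.compositionality comp_def)
qed (rule assms(1))

lemma complement_valid:
  "set h \<subseteq> {1..n} \<Longrightarrow> set (complement n h) \<subseteq> {1..n}" "sorted (complement n h)"
  "length (complement n h) = length h"
  by (auto simp: complement_def subset_iff)

lemma cnt_complement:
  assumes "set h \<subseteq> {1..n}" "x \<in> {1..n}" shows "cnt (complement n h) x = cnt h (n + 1 - x)"
  using assms by (induction h) (auto simp: complement_def cnt_def)

lemma complement_upd:
  assumes "set h \<subseteq> {1..n}" "x \<in> set h" "y \<in> {1..n}"
  shows "complement n (upd x y h) = upd (n + 1 - x) (n + 1 - y) (complement n h)"
proof -
  obtain M where M: "mset h = add_mset x M" using assms(2) by (metis multi_member_split set_mset_mset)
  show ?thesis
    unfolding complement_def[of n "upd x y h"]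
    by (rule properties_for_sort)
      (simp_all only: sorted_upd mset_upd mset_map complement_def mset_sort M, simp)
qed

lemma rev_complement_valid: "valid n H \<Longrightarrow> valid n (rev_complement n H)"
  using complement_valid by (auto simp: valid_def rev_complement_def)

lemma rev_complement_idem: "valid n H \<Longrightarrow> rev_complement n (rev_complement n H) = H"
  by (simp add: rev_complement_def rev_map comp_def) (auto simp: valid_def complement_complement intro!: map_idI)

text \<open>Reversing the tensor mirrors the bracket string, and complementation turns Opens into
  Closes and back. Thus the cancellations match, and the leftmost surviving Open becomes the
  rightmost surviving Close.\<close>

lemma rev_complement_ops:
  assumes "valid n H" "n \<ge> 2" "i < n"
  shows "phi n i (rev_complement n H) = eps n (dual_index n i) H"
    "eps n i (rev_complement n H) = phi n (dual_index n i) H"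
    "f_op n i (rev_complement n H) = map_option (rev_complement n) (e_op n (dual_index n i) H)"
proof -
  let ?i = "dual_index n i"
  note d = dual_index[OF assms(3)]
  have "phi n i (rev_complement n H) = eps n ?i H \<and> eps n i (rev_complement n H) = phi n ?i H \<and>
    f_op n i (rev_complement n H) = map_option (rev_complement n) (e_op n ?i H)"
    using assms(1)
  proof (induction H)
    case Nil
    then show ?case by (simp add: rev_complement_def)
  next
    case (Cons h H)
    have v: "valid n (rev_complement n H)" "valid n [complement n h]" and h: "sorted h" "set h \<subseteq> {1..n}"
      using Cons.prems rev_complement_valid complement_valid by auto
    have eq: "rev_complement n (g # X) = rev_complement n X @ [complement n g]" for g X
      by (simp add: rev_complement_def)
    note l = letters_le[OF assms(3,2)]
    have c: "cnt (complement n h) (close_letter n i) = cnt h (open_letter ?i)"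
      "cnt (complement n h) (open_letter i) = cnt h (close_letter n ?i)"
      using cnt_complement[OF h(2)] l(1,2) d(4,5) by simp_all
    have pe: "phi n i [complement n h] = cnt h (open_letter ?i)"
      "eps n i [complement n h] = cnt h (close_letter n ?i)"
      using complement_valid(2)[of n h] assms(2,3) c by (simp_all add: phi_Cons eps_Cons)
    have IH: "phi n i (rev_complement n H) = eps n ?i H" "eps n i (rev_complement n H) = phi n ?i H"
      "f_op n i (rev_complement n H) = map_option (rev_complement n) (e_op n ?i H)"
      using Cons by auto
    have up: "f_op n i [complement n h] = Some [complement n (upd (open_letter ?i) (close_letter n ?i) h)]"
      if "cnt h (open_letter ?i) > 0"
    proof -
      have "open_letter ?i \<in> set h" using that by (simp add: cnt_pos_iff)
      from complement_upd[OF h(2) this, of "close_letter n ?i"] letters_le[OF d(1) assms(2)]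
      have "complement n (upd (open_letter ?i) (close_letter n ?i) h)
          = upd (close_letter n i) (open_letter i) (complement n h)"
        using dual_index(4,5)[OF d(1)] d(2) by simp
      then show ?thesis
        using complement_valid(2)[of n h] assms(2,3) c that by (simp add: f_op_Cons)
    qed
    have "f_op n i (rev_complement n H @ [complement n h])
        = map_option (rev_complement n) (e_op n ?i (h # H))"
      unfolding f_op_append[OF assms(3,2) v] e_op_Cons[OF h(1) d(1) assms(2)] IH pe
      using up by (auto simp: option.map_comp comp_def eq)
    then show ?case
      unfolding eq phi_append[OF assms(3,2) v] eps_append[OF assms(3,2) v]
        phi_Cons[OF h(1) d(1) assms(2)] eps_Cons[OF h(1) d(1) assms(2)] IH pe by simp
  qed
  then show "phi n i (rev_complement n H) = eps n (dual_index n i) H"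
    "eps n i (rev_complement n H) = phi n (dual_index n i) H"
    "f_op n i (rev_complement n H) = map_option (rev_complement n) (e_op n (dual_index n i) H)"
    by blast+
qed

lemma rev_complement_e_op:
  assumes "valid n H" "n \<ge> 2" "i < n"
  shows "e_op n i (rev_complement n H) = map_option (rev_complement n) (f_op n (dual_index n i) H)"
proof -
  note d = dual_index[OF assms(3)]
  have vr: "valid n (rev_complement n H)" by (rule rev_complement_valid[OF assms(1)])
  have *: "f_op n (dual_index n i) H = map_option (rev_complement n) (e_op n i (rev_complement n H))"
    using rev_complement_ops(3)[OF vr assms(2) d(1)] rev_complement_idem[OF assms(1)] d(2) by simp
  show ?thesis
  proof (cases "e_op n i (rev_complement n H)")
    case (Some X)
    then have "valid n X" using e_op_valid[OF assms(3,2) vr] by blast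
    then show ?thesis using * Some by (simp add: rev_complement_idem)
  qed (use * in simp)
qed

section \<open>The map \<eta>\<close>

definition eta_indices :: "nat \<Rightarrow> nat list" where
  "eta_indices l = concat (map (\<lambda>k. [1..<k + 1]) (rev [1..<l]))"

lemma set_eta_indices: "set (eta_indices l) \<subseteq> {1..<l}"
  by (auto simp: eta_indices_def)

lemma eta_eq: "eta n H = rev_complement n (sigmas n (eta_indices (length H)) H)"
  by (simp add: eta_def sigma_minus_def eta_indices_def rev_complement_def complement_def[abs_def])

lemma eta_basic:
  assumes "valid n H" "n \<ge> 1"
  shows "valid n (eta n H)" "mset (map length (eta n H)) = mset (map length H)"
proof -
  note b = sigmas_basic[OF set_eta_indices assms]
  show "valid n (eta n H)" unfolding eta_eq using b(1) by (rule rev_complement_valid)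
  have "map length (rev_complement n X) = rev (map length X)" for X
    by (simp add: rev_complement_def rev_map complement_valid comp_def)
  then show "mset (map length (eta n H)) = mset (map length H)"
    unfolding eta_eq using b(3) by simp
qed

text \<open>The order of the factor lengths after \<eta> need not be computed: each sigma_i swaps
  two lengths whatever the letters are, so the resulting order depends on the old lengths
  alone.\<close>

lemma eta_lengths:
  assumes "valid n H" "valid n H'" "n \<ge> 1" "map length H' = map length H"
  shows "map length (eta n H') = map length (eta n H)"
proof -
  have "map length (rev_complement n X) = rev (map length X)" for X
    by (simp add: rev_complement_def rev_map complement_valid comp_def)
  moreover have "length H' = length H" using assms(4) by (rule map_eq_imp_length_eq)
  ultimately show ?thesis
    unfolding eta_eq using sigmas_lengths[OF set_eta_indices assms(1,2,3,4)] by simp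
qed

lemma eta_inject:
  assumes "valid n H" "valid n H'" "n \<ge> 1" "length H' = length H" "eta n H = eta n H'"
  shows "H = H'"
proof -
  have "sigmas n (eta_indices (length H)) H = sigmas n (eta_indices (length H)) H'"
    using assms(5,4) rev_complement_idem[OF sigmas_basic(1)[OF set_eta_indices assms(1,3)]]
      rev_complement_idem[OF sigmas_basic(1)[OF set_eta_indices assms(2,3)]]
    unfolding eta_eq by metis
  then show ?thesis
    by (rule sigmas_inject[OF set_eta_indices assms(4,1,2,3)])
qed

lemma eta_ops:
  assumes "valid n H" "n \<ge> 2" "i < n"
  shows "f_op n i (eta n H) = map_option (eta n) (e_op n (dual_index n i) H)"
    "e_op n i (eta n H) = map_option (eta n) (f_op n (dual_index n i) H)"
proof -
  have n1: "n \<ge> 1" using assms by simp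
  note d = dual_index(1)[OF assms(3)]
  note b = sigmas_basic(1)[OF set_eta_indices assms(1) n1]
  note o = sigmas_ops[OF set_eta_indices assms(1,2) d]
  have le: "length H' = length H" if "e_op n (dual_index n i) H = Some H'" for H'
    using e_op_valid[OF d assms(2,1) that] by (auto dest: map_eq_imp_length_eq)
  have lf: "length H' = length H" if "f_op n (dual_index n i) H = Some H'" for H'
    using f_op_valid[OF d assms(2,1) that] by (auto dest: map_eq_imp_length_eq)
  show "f_op n i (eta n H) = map_option (eta n) (e_op n (dual_index n i) H)"
    using rev_complement_ops(3)[OF b assms(2,3)] o(2) le
    unfolding eta_eq[of n H] by (cases "e_op n (dual_index n i) H") (simp_all add: eta_eq)
  show "e_op n i (eta n H) = map_option (eta n) (f_op n (dual_index n i) H)"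
    using rev_complement_e_op[OF b assms(2,3)] o(1) lf
    unfolding eta_eq[of n H] by (cases "f_op n (dual_index n i) H") (simp_all add: eta_eq)
qed

section \<open>Connectedness\<close>

lemma listset_words: "listset (map (words n) ks) = {H. valid n H \<and> map length H = ks}"
proof (induction ks)
  case (Cons k ks)
  show ?case
    unfolding list.map listset.simps Cons set_Cons_def
    by (auto simp: words_def map_eq_Cons_conv)
qed auto

lemma tensors_iff: "H \<in> tensors n \<mu> \<longleftrightarrow> valid n H \<and> map length H = rev \<mu>"
  by (simp add: tensors_def listset_words)

lemma finite_tensors: "finite (tensors n \<mu>)"
proof -
  have "finite (listset (map (words n) ks))" for ks
  proof (induction ks)
    case (Cons k ks)
    have "set_Cons A B = (\<lambda>(x, y). x # y) ` (A \<times> B)" for A :: "nat list set" and B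
      by (auto simp: set_Cons_def)
    then show ?case using Cons finite_words by simp
  qed simp
  then show ?thesis by (simp add: tensors_def)
qed

lemma arcs_ends_dual_regular_subgraph:
  "(H, H') \<in> arcs_ends (dual_regular_subgraph n \<mu>) \<longleftrightarrow>
    H \<in> tensors n \<mu> \<and> (\<exists>i<n. f_op n i H = Some H' \<and>
      (i = 0 \<longrightarrow> e_op n 0 H' = Some H \<and> dual_energy n H = dual_energy n H' + 1))"
  unfolding arcs_ends_conv
  by (force simp: dual_regular_subgraph_def crystal_graph_def dual_regular_def image_iff)

text \<open>Reachability along arrows in either direction inside the vertex set, the form in which
  \<open>connected_conv\<close> expresses connectedness.\<close>

definition linked :: "nat \<Rightarrow> nat list \<Rightarrow> (tensor \<times> tensor) set" where
  "linked n \<mu> = rtrancl_on (tensors n \<mu>) ((arcs_ends (dual_regular_subgraph n \<mu>))\<^sup>s)"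

lemma sym_linked: "(H, H') \<in> linked n \<mu> \<Longrightarrow> (H', H) \<in> linked n \<mu>"
proof -
  have "sym (linked n \<mu>)" unfolding linked_def
    by (rule rtrancl_on_sym) (auto simp: symcl_def intro: symI)
  then show "(H, H') \<in> linked n \<mu> \<Longrightarrow> (H', H) \<in> linked n \<mu>" by (rule symD)
qed

lemma linked_trans: "(H, H') \<in> linked n \<mu> \<Longrightarrow> (H', H'') \<in> linked n \<mu> \<Longrightarrow> (H, H'') \<in> linked n \<mu>"
  unfolding linked_def by (rule rtrancl_on_trans)

lemma linked_tensors: "(H, H') \<in> linked n \<mu> \<Longrightarrow> H' \<in> tensors n \<mu>"
  unfolding linked_def by (rule in_rtrancl_on_in_F)

lemma linked_f_op:
  assumes "H \<in> tensors n \<mu>" "n \<ge> 2" "i < n" "f_op n i H = Some H'"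
    "i = 0 \<Longrightarrow> dual_energy n H = dual_energy n H' + 1"
  shows "(H, H') \<in> linked n \<mu>"
proof -
  have H: "valid n H" "map length H = rev \<mu>" using assms(1) by (simp_all add: tensors_iff)
  have "H' \<in> tensors n \<mu>"
    using f_op_valid[OF assms(3,2) H(1) assms(4)] H(2) by (simp add: tensors_iff)
  moreover have "e_op n i H' = Some H" using f_op_inverse[OF assms(3,2) H(1) assms(4)] by blast
  then have "(H, H') \<in> arcs_ends (dual_regular_subgraph n \<mu>)"
    unfolding arcs_ends_dual_regular_subgraph using assms by blast
  ultimately show ?thesis
    unfolding linked_def using assms(1)
    by (intro rtrancl_on_into_rtrancl_on[OF rtrancl_on_refl]) (auto simp: symcl_def)
qed

lemma linked_e_op:
  assumes "H \<in> tensors n \<mu>" "n \<ge> 2" "i < n" "e_op n i H = Some H'"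
    "i = 0 \<Longrightarrow> dual_energy n H' = dual_energy n H + 1"
  shows "(H, H') \<in> linked n \<mu>"
proof -
  have H: "valid n H" "map length H = rev \<mu>" using assms(1) by (simp_all add: tensors_iff)
  have "H' \<in> tensors n \<mu>"
    using e_op_valid[OF assms(3,2) H(1) assms(4)] H(2) by (simp add: tensors_iff)
  then have "(H', H) \<in> linked n \<mu>"
    by (rule linked_f_op[OF _ assms(2,3) e_op_inverse[OF assms(3,2) H(1) assms(4)] assms(5)])
  then show ?thesis by (rule sym_linked)
qed

text \<open>Pulls a step at \<eta>(H) back to a step at H. As f_0 at \<eta>(H) corresponds to e_0 at
  H, an increase of the energy by 1 is precisely dual regularity of the arrow used.\<close>

lemma linked_eta_f_op:
  assumes "H \<in> tensors n \<mu>" "n \<ge> 2" "i < n" "f_op n i (eta n H) = Some G"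
    "i = 0 \<Longrightarrow> energy n G = energy n (eta n H) + 1"
  shows "\<exists>H'. (H, H') \<in> linked n \<mu> \<and> eta n H' = G"
proof -
  have "valid n H" using assms(1) by (simp add: tensors_iff)
  from eta_ops(1)[OF this assms(2,3)] have "map_option (eta n) (e_op n (dual_index n i) H) = Some G"
    using assms(4) by simp
  then obtain H' where H': "e_op n (dual_index n i) H = Some H'" "eta n H' = G" by auto
  then have "(H, H') \<in> linked n \<mu>"
    using assms(5) dual_index(1,3)[OF assms(3)]
    by (intro linked_e_op[OF assms(1,2) _ H'(1)]) (auto simp: dual_energy_def)
  then show ?thesis using H'(2) by blast
qed

lemma linked_eta_e_op:
  assumes "H \<in> tensors n \<mu>" "n \<ge> 2" "i \<in> {1..<n}" "e_op n i (eta n H) = Some G"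
  shows "\<exists>H'. (H, H') \<in> linked n \<mu> \<and> eta n H' = G"
proof -
  have i: "i < n" using assms(3) by simp
  have "valid n H" using assms(1) by (simp add: tensors_iff)
  from eta_ops(2)[OF this assms(2) i] have "map_option (eta n) (f_op n (dual_index n i) H) = Some G"
    using assms(4) by simp
  then obtain H' where H': "f_op n (dual_index n i) H = Some H'" "eta n H' = G" by auto
  then have "(H, H') \<in> linked n \<mu>"
    using dual_index(1,3)[OF i] assms(3)
    by (intro linked_f_op[OF assms(1,2) _ H'(1)]) auto
  then show ?thesis using H'(2) by blast
qed

lemma linked_eta_path:
  assumes "(classical_step n)\<^sup>*\<^sup>* (eta n H) G" "H \<in> tensors n \<mu>" "n \<ge> 2"
  shows "\<exists>H'. (H, H') \<in> linked n \<mu> \<and> eta n H' = G"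
  using assms(1)
proof (induction rule: rtranclp_induct)
  case base
  then show ?case using assms(2) unfolding linked_def by blast
next
  case (step Y Z)
  then obtain H' i where H': "(H, H') \<in> linked n \<mu>" "eta n H' = Y" "i \<in> {1..<n}" "f_op n i Y = Some Z"
    by (auto simp: classical_step_def)
  then obtain H'' where "(H', H'') \<in> linked n \<mu>" "eta n H'' = Z"
    using linked_eta_f_op[OF linked_tensors[OF H'(1)] assms(3), of i Z] by auto
  then show ?case using H'(1) linked_trans by blast
qed

text \<open>The measure for which the ascent to a highest weight tensor terminates: a classical
  \<open>e_op\<close> replaces one letter i + 1 by i.\<close>

lemma e_op_sum_less:
  assumes "valid n H" "n \<ge> 2" "i \<in> {1..<n}" "e_op n i H = Some H'"
  shows "sum_list (concat H') < sum_list (concat H)"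
  using assms(1,4)
proof (induction H arbitrary: H')
  case (Cons h H)
  have i: "i < n" "close_letter n i = i" "open_letter i = Suc i"
    using assms(3) by (auto simp: open_letter_def close_letter_def)
  show ?case
  proof (cases "cnt h (Suc i) > phi n i H")
    case True
    then have H': "H' = upd (Suc i) i h # H"
      using Cons.prems i assms(2) by (auto simp: e_op_Cons)
    have "cnt h (Suc i) > 0" using True by simp
    then have "Suc i \<in># mset h" using cnt_pos_iff[of h "Suc i"] by simp
    then obtain M where M: "mset h = add_mset (Suc i) M" by (metis multi_member_split)
    then have "sum_list h = Suc i + sum_mset M" "sum_list (upd (Suc i) i h) = i + sum_mset M"
      by (simp_all add: sum_mset_sum_list[symmetric] mset_upd)
    then show ?thesis unfolding H' by simp
  next
    case False
    then show ?thesis using Cons i assms(2) by (auto simp: e_op_Cons)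
  qed
qed simp

lemma linked_highest:
  assumes "H \<in> tensors n \<mu>" "n \<ge> 2"
  shows "\<exists>H'. (H, H') \<in> linked n \<mu> \<and> highest n (eta n H') \<and> dual_energy n H' = dual_energy n H"
  using assms(1)
proof (induction "sum_list (concat (eta n H))" arbitrary: H rule: less_induct)
  case less
  show ?case
  proof (cases "highest n (eta n H)")
    case True
    then show ?thesis using less.prems unfolding linked_def by blast
  next
    case False
    then obtain i G where i: "i \<in> {1..<n}" "e_op n i (eta n H) = Some G"
      by (auto simp: highest_def)
    have v: "valid n (eta n H)" using eta_basic(1) less.prems assms(2) by (simp add: tensors_iff)
    then have "sum_list (concat G) < sum_list (concat (eta n H))"
      by (rule e_op_sum_less[OF _ assms(2) i])
    have "i < n" using i(1) by simp
    then have "valid n G" "f_op n i G = Some (eta n H)"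
      using e_op_valid[OF _ assms(2) v i(2)] e_op_inverse[OF _ assms(2) v i(2)] by blast+
    then have e: "energy n G = energy n (eta n H)"
      using energy_f_op[of n G i "eta n H"] i(1) assms(2) by simp
    moreover obtain H1 where H1: "(H, H1) \<in> linked n \<mu>" "eta n H1 = G"
      using linked_eta_e_op[OF less.prems assms(2) i] by blast
    ultimately obtain H2 where "(H1, H2) \<in> linked n \<mu>" "highest n (eta n H2)"
      "dual_energy n H2 = dual_energy n H1"
      using less.hyps[of H1] linked_tensors[OF H1(1)] \<open>sum_list (concat G) < _\<close> by blast
    then show ?thesis using H1 e linked_trans unfolding dual_energy_def by metis
  qed
qed

lemma support_size_eta:
  assumes "H \<in> tensors n \<mu>" "n \<ge> 1"
  shows "support_size (eta n H) = card {j. j < length \<mu> \<and> \<mu> ! j \<noteq> 0}"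
proof -
  have H: "valid n H" "map length H = rev \<mu>" using assms(1) by (simp_all add: tensors_iff)
  have "support_size (eta n H) = length (filter (\<lambda>k. k \<noteq> 0) (map length (eta n H)))"
    by (simp add: filter_map comp_def)
  also have "\<dots> = size (filter_mset (\<lambda>k. k \<noteq> 0) (mset (map length (eta n H))))"
    by (simp only: mset_filter[symmetric] size_mset)
  also have "mset (map length (eta n H)) = mset \<mu>"
    using eta_basic(2)[OF H(1) assms(2)] H(2) by simp
  also have "size (filter_mset (\<lambda>k. k \<noteq> 0) (mset \<mu>)) = length (filter (\<lambda>k. k \<noteq> 0) \<mu>)"
    by (simp only: mset_filter[symmetric] size_mset)
  finally show ?thesis by (simp only: length_filter_conv_card)
qed

lemma linked_all_ones:
  assumes "H \<in> tensors n \<mu>" "n \<ge> 2" "card {j. j < length \<mu> \<and> \<mu> ! j \<noteq> 0} \<le> n"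
  shows "\<exists>H'. (H, H') \<in> linked n \<mu> \<and> set (concat (eta n H')) \<subseteq> {1}"
  using assms(1)
proof (induction "Max (dual_energy n ` tensors n \<mu>) - dual_energy n H" arbitrary: H rule: less_induct)
  case less
  obtain H1 where H1: "(H, H1) \<in> linked n \<mu>" "highest n (eta n H1)"
    "dual_energy n H1 = dual_energy n H"
    using linked_highest[OF less.prems assms(2)] by blast
  show ?case
  proof (cases "set (concat (eta n H1)) \<subseteq> {1}")
    case True
    then show ?thesis using H1 by blast
  next
    case False
    have n1: "n \<ge> 1" using assms(2) by simp
    have H1t: "H1 \<in> tensors n \<mu>" by (rule linked_tensors[OF H1(1)])
    have "valid n (eta n H1)" using H1t eta_basic(1) n1 by (simp add: tensors_iff)
    moreover have "support_size (eta n H1) \<le> n" using support_size_eta[OF H1t n1] assms(3) by simp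
    ultimately obtain G1 G2 where G: "(classical_step n)\<^sup>*\<^sup>* (eta n H1) G1" "f_op n 0 G1 = Some G2"
      "energy n G2 = energy n (eta n H1) + 1"
      using raise_energy[OF _ assms(2) H1(2) False] by blast
    have e1: "energy n G1 = energy n (eta n H1)"
      using classical_path_energy[OF G(1) \<open>valid n (eta n H1)\<close> assms(2)] by blast
    obtain H2 where H2: "(H1, H2) \<in> linked n \<mu>" "eta n H2 = G1"
      using linked_eta_path[OF G(1) H1t assms(2)] by blast
    obtain H3 where H3: "(H2, H3) \<in> linked n \<mu>" "eta n H3 = G2"
      using linked_eta_f_op[OF linked_tensors[OF H2(1)] assms(2), of 0 G2] assms(2) G H2(2) e1 by auto
    have H3t: "H3 \<in> tensors n \<mu>" by (rule linked_tensors[OF H3(1)])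
    have "dual_energy n H3 = dual_energy n H + 1"
      using H1(3) H3(2) G(3) by (simp add: dual_energy_def)
    moreover have "dual_energy n H3 \<le> Max (dual_energy n ` tensors n \<mu>)"
      using H3t finite_tensors by simp
    ultimately have "Max (dual_energy n ` tensors n \<mu>) - dual_energy n H3
        < Max (dual_energy n ` tensors n \<mu>) - dual_energy n H" by linarith
    from less.hyps[OF this H3t] show ?thesis
      using linked_trans[OF H1(1) linked_trans[OF H2(1) H3(1)]] linked_trans by blast
  qed
qed

lemma all_ones_unique:
  assumes "valid n G" "valid n G'" "map length G = map length G'"
    "set (concat G) \<subseteq> {1}" "set (concat G') \<subseteq> {1}"
  shows "G = G'"
proof -
  have *: "X = map (\<lambda>k. replicate k 1) (map length X)" if "set (concat X) \<subseteq> {1}" for X :: tensor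
    using that by (induction X) (auto intro!: replicate_length_same[symmetric])
  show ?thesis
    using *[OF assms(4)] *[OF assms(5)] assms(3) by metis
qed

theorem theorem5p39:
  fixes n :: nat and \<mu> :: "nat list"
  assumes "n \<ge> 2"
    and "card {j. j < length \<mu> \<and> \<mu> ! j \<noteq> 0} \<le> n"
  shows "Digraph_Component.connected (dual_regular_subgraph n \<mu>)"
proof -
  have n1: "n \<ge> 1" using assms(1) by simp
  have verts: "verts (dual_regular_subgraph n \<mu>) = tensors n \<mu>"
    by (simp add: dual_regular_subgraph_def crystal_graph_def)
  \<comment> \<open>Connectedness includes that there is a vertex; this one is the witness.\<close>
  have "map (\<lambda>k. replicate k 1) (rev \<mu>) \<in> tensors n \<mu>"
    using assms(1) by (auto simp: tensors_iff valid_def comp_def)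
  moreover have "(H, H') \<in> linked n \<mu>" if H: "H \<in> tensors n \<mu>" "H' \<in> tensors n \<mu>" for H H'
  proof -
    obtain K where K: "(H, K) \<in> linked n \<mu>" "set (concat (eta n K)) \<subseteq> {1}"
      using linked_all_ones[OF H(1) assms] by blast
    obtain K' where K': "(H', K') \<in> linked n \<mu>" "set (concat (eta n K')) \<subseteq> {1}"
      using linked_all_ones[OF H(2) assms] by blast
    have v: "valid n K" "valid n K'" and l: "map length K' = map length K"
      using linked_tensors[OF K(1)] linked_tensors[OF K'(1)] by (simp_all add: tensors_iff)
    \<comment> \<open>Both tensors consist of letters 1 only, so they are determined by their factor
      lengths in order, which agree because K and K' have the same shape.\<close>
    have "eta n K = eta n K'"
      using all_ones_unique[OF eta_basic(1)[OF v(1) n1] eta_basic(1)[OF v(2) n1] _ K(2) K'(2)]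
        eta_lengths[OF v n1 l] by simp
    then have "K = K'"
      using eta_inject[OF v n1] map_eq_imp_length_eq[OF l] by blast
    then show ?thesis using K(1) sym_linked[OF K'(1)] linked_trans by blast
  qed
  ultimately show ?thesis
    unfolding connected_conv verts linked_def by blast
qed

end
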